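(* Fix $c_0\in\mathfrak{h}^*$ and set $c_t=c_0-ta_H$ for $t\in\mathbb{R}$. Then the family of maps $\{F_t\colon(\mu_H^{-1}(c_0)\cap L)\times H\to M\}_{t\in\mathbb{R}}$ defined by $F_t(p,h)=\gamma_p(t)h$ is a Lagrangian mean curvature flow.
   Context: $M=\mathbb{C}^{d+1}$ with its standard complex structure $I$, K\"ahler form $\omega$, holomorphic volume form $\Omega=dz_1\wedge\dots\wedge dz_{d+1}$ and flat metric $g$. $H=\mathbb{R}$ with Lie algebra $\mathfrak{h}$; $\xi_0\in\mathfrak{h}$ is such that $\mathrm{Exp}_Ht\xi_0=t$, and $\xi^0\in\mathfrak{h}^*$ satisfies $\langle\xi^0,\xi_0\rangle=1$. Fix $\lambda_1,\dots,\lambda_d\in\mathbb{R}$; $H$ acts on $M$ by $z\,\mathrm{Exp}_Ht\xi_0=(z_1e^{\sqrt{-1}\lambda_1t},\dots,z_de^{\sqrt{-1}\lambda_dt},z_{d+1}+\sqrt{-1}t)$, with moment map $\mu_H(z)=(\frac12\sum_{i=1}^d\lambda_i|z_i|^2+\mathrm{Re}\,z_{d+1})\xi^0$. Put $a_H=(\lambda_1+\dots+\lambda_d)\xi^0$ and $L=\mathbb{R}^{d+1}\subset M$. For $\xi\in\mathfrak{h}$, $\xi^\#$ is the vector field on $M$ generated by $\xi$. For $x\in L$ let $\tilde\xi(x)\in\mathfrak{h}$ be defined by $g_x(\tilde\xi(x)^\#_x,\eta^\#_x)=\langle a_H,\eta\rangle$ for all $\eta\in\mathfrak{h}$, and let $\chi_x=I_x\tilde\xi(x)^\#_x\in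 T_xL$; this is a vector field on $L$. For $p\in L$, $\gamma_p$ is the integral curve of $\chi$ with $\gamma_p(0)=p$; its existence on all of $\mathbb{R}$ is part of the assertion. A Lagrangian mean curvature flow is a smooth family of Lagrangian immersions $F_t$ such that $\frac{\partial F_t}{\partial t}$ equals the mean curvature vector of $F_t$. *)

theory Defs
  imports "HOL-Analysis.Analysis"
begin

section \<open>Smooth maps and submanifolds of Euclidean space\<close>

text \<open>Only meaningful, and only used, for open \<open>S\<close>, since the derivative is taken in the full
  neighbourhood filter \<open>at x\<close>.\<close>

fun Ck_on :: "nat \<Rightarrow> ('a::euclidean_space \<Rightarrow> 'b::real_normed_vector) \<Rightarrow> 'a set \<Rightarrow> bool" where
  "Ck_on 0 f S \<longleftrightarrow> continuous_on S f"
| "Ck_on (Suc k) f S \<longleftrightarrow>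
     f differentiable_on S \<and> (\<forall>v. Ck_on k (\<lambda>x. frechet_derivative f (at x) v) S)"

definition smooth_on :: "'a::euclidean_space set \<Rightarrow> ('a \<Rightarrow> 'b::real_normed_vector) \<Rightarrow> bool" where
  "smooth_on S f \<longleftrightarrow> (\<forall>k. Ck_on k f S)"

definition immersion_on :: "'a::euclidean_space set \<Rightarrow> ('a \<Rightarrow> 'b::real_normed_vector) \<Rightarrow> bool" where
  "immersion_on U f \<longleftrightarrow> smooth_on U f \<and> (\<forall>u\<in>U. inj (frechet_derivative f (at u)))"

definition local_param ::
  "'e::euclidean_space set \<Rightarrow> (real^'n) set \<Rightarrow> (real^'n \<Rightarrow> 'e) \<Rightarrow> bool" where
  "local_param N U \<phi> \<longleftrightarrow>
     open U \<and> immersion_on U \<phi> \<and> openin (top_of_set N) (\<phi> ` U) \<and>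
     (\<exists>\<psi>. homeomorphism U (\<phi> ` U) \<phi> \<psi>)"

text \<open>Embedded submanifolds without boundary, of dimension \<open>CARD('n)\<close>.\<close>

definition submanifold :: "'n::finite itself \<Rightarrow> 'e::euclidean_space set \<Rightarrow> bool" where
  "submanifold _ N \<longleftrightarrow>
     (\<forall>p\<in>N. \<exists>(U :: (real^'n) set) \<phi>. local_param N U \<phi> \<and> p \<in> \<phi> ` U)"

section \<open>Mean curvature vector of an immersion into a Euclidean space\<close>

definition pderiv_vec :: "'n \<Rightarrow> (real^'n \<Rightarrow> 'e) \<Rightarrow> real^'n \<Rightarrow> 'e::euclidean_space" where
  "pderiv_vec i f u = frechet_derivative f (at u) (axis i 1)"

definition induced_metric :: "(real^'n \<Rightarrow> 'e::euclidean_space) \<Rightarrow> real^'n \<Rightarrow> real^'n^'n" where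
  "induced_metric f u = (\<chi> i j. pderiv_vec i f u \<bullet> pderiv_vec j f u)"

definition normal_component ::
  "(real^'n \<Rightarrow> 'e::euclidean_space) \<Rightarrow> real^'n \<Rightarrow> 'e \<Rightarrow> 'e" where
  "normal_component f u w =
     (THE \<nu>. w - \<nu> \<in> range (frechet_derivative f (at u)) \<and>
            (\<forall>v. \<nu> \<bullet> frechet_derivative f (at u) v = 0))"

text \<open>As the ambient metric is flat, the second fundamental form is the normal component of
  the ordinary second derivative. The mean curvature vector is its trace with respect to the
  induced metric (not divided by the dimension).\<close>

definition second_fundamental_form ::
  "(real^'n \<Rightarrow> 'e::euclidean_space) \<Rightarrow> real^'n \<Rightarrow> 'n \<Rightarrow> 'n \<Rightarrow> 'e" where
  "second_fundamental_form f u i j = normal_component f u (pderiv_vec i (pderiv_vec j f) u)"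

definition mean_curvature_vector ::
  "(real^'n \<Rightarrow> 'e::euclidean_space) \<Rightarrow> real^'n \<Rightarrow> 'e" where
  "mean_curvature_vector f u =
     (\<Sum>i\<in>UNIV. \<Sum>j\<in>UNIV.
        matrix_inv (induced_metric f u) $ i $ j *\<^sub>R second_fundamental_form f u i j)"

section \<open>Lagrangian mean curvature flow in complex space\<close>

text \<open>The flat metric \<open>g\<close> on \<open>complex^'n\<close> is the (real) inner product.\<close>

definition cplx_structure :: "complex^'n \<Rightarrow> complex^'n" where
  "cplx_structure v = (\<chi> i. \<i> * v $ i)"

definition kaehler_form :: "complex^'n \<Rightarrow> complex^'n \<Rightarrow> real" where
  "kaehler_form v w = cplx_structure v \<bullet> w"

text \<open>Maps on a submanifold \<open>N\<close> are tested in all local parametrizations. The type forces the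
  dimension of \<open>N\<close> to be half the real dimension of the target.\<close>

definition lagrangian_immersion ::
  "'e::euclidean_space set \<Rightarrow> ('e \<Rightarrow> complex^'n) \<Rightarrow> bool" where
  "lagrangian_immersion N f \<longleftrightarrow>
     submanifold TYPE('n) N \<and>
     (\<forall>(U :: (real^'n) set) \<phi>. local_param N U \<phi> \<longrightarrow>
        immersion_on U (f \<circ> \<phi>) \<and>
        (\<forall>u\<in>U. \<forall>v w. kaehler_form (frechet_derivative (f \<circ> \<phi>) (at u) v)
                                  (frechet_derivative (f \<circ> \<phi>) (at u) w) = 0))"

definition lagrangian_mean_curvature_flow ::
  "'e::euclidean_space set \<Rightarrow> (real \<Rightarrow> 'e \<Rightarrow> complex^'n) \<Rightarrow> bool" where
  "lagrangian_mean_curvature_flow N F \<longleftrightarrow>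
     (\<forall>t. lagrangian_immersion N (F t)) \<and>
     (\<forall>(U :: (real^'n) set) \<phi>. local_param N U \<phi> \<longrightarrow>
        smooth_on (UNIV \<times> U) (\<lambda>(t, u). F t (\<phi> u)) \<and>
        (\<forall>t. \<forall>u\<in>U. ((\<lambda>s. F s (\<phi> u)) has_vector_derivative
                        mean_curvature_vector (F t \<circ> \<phi>) u) (at t)))"

section \<open>The Hamiltonian action of the real line\<close>

text \<open>The \<open>d + 1\<close> complex coordinates are indexed by \<open>'d option\<close>: \<open>Some i\<close> with \<open>i :: 'd\<close> for the
  first \<open>d\<close> and \<open>None\<close> for the last. Both \<open>H\<close> and its Lie algebra are \<open>real\<close>, with \<open>\<xi>\<^sub>0 = 1\<close>, so
  that the exponential map is the identity. The dual of the Lie algebra is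
  \<open>real \<Rightarrow>\<^sub>L real\<close>, in which \<open>\<xi>\<^sup>0\<close> is \<open>id_blinfun\<close>.\<close>

definition act :: "('d \<Rightarrow> real) \<Rightarrow> complex^('d::finite option) \<Rightarrow> real \<Rightarrow> complex^('d option)" where
  "act lam z t = (\<chi> k. case k of
      Some i \<Rightarrow> z $ Some i * exp (\<i> * of_real (lam i * t))
    | None \<Rightarrow> z $ None + \<i> * of_real t)"

definition moment_map :: "('d \<Rightarrow> real) \<Rightarrow> complex^('d::finite option) \<Rightarrow> (real \<Rightarrow>\<^sub>L real)" where
  "moment_map lam z =
     ((1/2) * (\<Sum>i\<in>UNIV. lam i * (cmod (z $ Some i))\<^sup>2) + Re (z $ None)) *\<^sub>R id_blinfun"

definition a_H :: "('d::finite \<Rightarrow> real) \<Rightarrow> (real \<Rightarrow>\<^sub>L real)" where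
  "a_H lam = (\<Sum>i\<in>UNIV. lam i) *\<^sub>R id_blinfun"

definition real_points :: "(complex^'n) set" where
  "real_points = {z. \<forall>i. z $ i \<in> \<real>}"

text \<open>The vector field \<open>\<xi>\<^sup>#\<close> generated by \<open>\<xi>\<close>.\<close>

definition fundamental_vf ::
  "('d \<Rightarrow> real) \<Rightarrow> real \<Rightarrow> complex^('d::finite option) \<Rightarrow> complex^('d option)" where
  "fundamental_vf lam \<xi> z = vector_derivative (\<lambda>t. act lam z (t *\<^sub>R \<xi>)) (at 0)"

definition xi_tilde :: "('d \<Rightarrow> real) \<Rightarrow> complex^('d::finite option) \<Rightarrow> real" where
  "xi_tilde lam x =
     (THE \<xi>. \<forall>\<eta>. fundamental_vf lam \<xi> x \<bullet> fundamental_vf lam \<eta> x = blinfun_apply (a_H lam) \<eta>)"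

definition chi_vf :: "('d \<Rightarrow> real) \<Rightarrow> complex^('d::finite option) \<Rightarrow> complex^('d option)" where
  "chi_vf lam x = cplx_structure (fundamental_vf lam (xi_tilde lam x) x)"

definition is_chi_curve ::
  "('d \<Rightarrow> real) \<Rightarrow> complex^('d::finite option) \<Rightarrow> (real \<Rightarrow> complex^('d option)) \<Rightarrow> bool" where
  "is_chi_curve lam p \<gamma> \<longleftrightarrow>
     \<gamma> 0 = p \<and>
     (\<forall>t. \<gamma> t \<in> real_points \<and> (\<gamma> has_vector_derivative chi_vf lam (\<gamma> t)) (at t))"

definition chi_curve ::
  "('d \<Rightarrow> real) \<Rightarrow> complex^('d::finite option) \<Rightarrow> real \<Rightarrow> complex^('d option)" where
  "chi_curve lam p = (THE \<gamma>. is_chi_curve lam p \<gamma>)"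

end

theory Submission
  imports Defs
begin

text \<open>
Let \<open>a = \<lambda>\<^sub>1 + \<dots> + \<lambda>\<^sub>d\<close>, let \<open>\<Lambda>\<close> be the diagonal matrix with entries \<open>\<lambda>\<^sub>1, \<dots>, \<lambda>\<^sub>d, 0\<close>, let \<open>e\<close> be
the last unit vector, and for a real point \<open>X\<close> let \<open>n = \<Lambda> X + e\<close>, the gradient of the moment map
on \<open>L\<close>. The action is generated by \<open>\<i> n\<close>, so that \<open>\<chi> = - (a / |n|\<^sup>2) n\<close>.

\<^bold>\<open>The curves.\<close> The field \<open>n\<close> generates the action of the imaginary direction of the complexified
group, \<open>p \<mapsto> exp (s \<Lambda>) p + s e\<close>, so an integral curve of \<open>\<chi>\<close> is this flow run with a
new clock \<open>s (t)\<close>. Along it the moment map changes at the constant rate \<open>- a\<close>, that is,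
\<open>rise p (s (t)) = - t a\<close>, where \<open>rise p s\<close> is the gain of the moment map after parameter \<open>s\<close>.
Since \<open>rise p\<close> has derivative \<open>|n|\<^sup>2 \<ge> 1\<close>, it is a bijection of the line; this gives existence for
all times, uniqueness (\<open>is_chi_curve_iff\<close>), and, by differentiating the implicit equation, smoothness
of \<open>s\<close> in time and initial point (\<open>Ck_on_height\<close>).

\<^bold>\<open>The immersions.\<close> In a chart, \<open>F\<^sub>t = exp (\<i> h \<Lambda>) X + \<i> h e\<close> with \<open>X\<close> moving in a level set of
the moment map on \<open>L\<close>. Up to the unitary matrix \<open>exp (\<i> h \<Lambda>)\<close> its derivative is
\<open>dX + \<i> dh n\<close> with \<open>dX\<close> real and orthogonal to \<open>n\<close>; hence \<open>F\<^sub>t\<close> is Lagrangian, with normal space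
\<open>\<real> n \<oplus> \<i> n\<^sup>\<bottom>\<close>.

\<^bold>\<open>The mean curvature.\<close> The partial derivatives \<open>D\<^sub>i\<close> of a Lagrangian immersion form a complex basis
whose Hermitian Gram matrix is the real matrix \<open>g\<close>, so with the inverse \<open>\<gamma>\<close> of \<open>g\<close> the sum of
\<open>\<gamma>\<^sub>i\<^sub>j D\<^sub>i D\<^sub>j\<^sup>*\<close> is the identity matrix (\<open>lagrangian_frame_complete\<close>). Differentiating
\<open>\<langle>n, dX\<rangle> = 0\<close> shows that the pairing of the second derivative with \<open>n\<close> is
\<open>- \<langle>\<Lambda> D\<^sub>i, D\<^sub>j\<rangle>\<close>; its trace is therefore \<open>- tr \<Lambda> = - a\<close>. The remaining normal part, in
\<open>\<i> n\<^sup>\<bottom>\<close>, comes from the mixed terms \<open>\<partial>\<^sub>i h \<partial>\<^sub>j X\<close>, and the imaginary part of the same identity makes its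
trace vanish. So the mean curvature vector is \<open>- (a / |n|\<^sup>2) exp (\<i> h \<Lambda>) n\<close>, which is \<open>\<chi>\<close> carried along by
the group element \<open>h\<close>, the time derivative of \<open>F\<^sub>t\<close>. No
normalization of the chart enters, so the computation applies to every local parametrization at once.
\<close>

section \<open>Closure properties of maps of class \<open>C\<^sup>k\<close>\<close>

lemma Ck_on_has_derivative:
  assumes "Ck_on (Suc k) f S" "open S" "x \<in> S"
  shows "(f has_derivative frechet_derivative f (at x)) (at x)"
  using assms by (simp add: differentiable_on_eq_differentiable_at frechet_derivative_works)

lemma Ck_on_cong:
  assumes "Ck_on k f S" "open S" "\<And>x. x \<in> S \<Longrightarrow> f x = g x"
  shows "Ck_on k g S"
  using assms(1,3)
proof (induction k arbitrary: f g)
  case 0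
  then show ?case by (auto cong: continuous_on_cong)
next
  case (Suc k)
  have D: "(g has_derivative frechet_derivative f (at x)) (at x)" if "x \<in> S" for x
    using has_derivative_transform_within_open[OF Ck_on_has_derivative[OF Suc.prems(1) \<open>open S\<close> that] \<open>open S\<close> that]
      Suc.prems(2) by blast
  have eq: "frechet_derivative f (at x) = frechet_derivative g (at x)" if "x \<in> S" for x
    using frechet_derivative_at[OF D[OF that]] .
  have "Ck_on k (\<lambda>x. frechet_derivative g (at x) v) S" for v
    by (rule Suc.IH[of "\<lambda>x. frechet_derivative f (at x) v"]) (use Suc.prems(1) eq in auto)
  moreover have "g differentiable_on S"
    using D \<open>open S\<close> by (auto simp: differentiable_on_eq_differentiable_at differentiable_def)
  ultimately show ?case by simp
qed

text \<open>The predicate \<open>Ck_on\<close> recurses through \<open>frechet_derivative\<close>; this rule lets every induction below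
supply an explicit formula for the derivative instead.\<close>

lemma Ck_on_SucI:
  assumes "open S" "\<And>x. x \<in> S \<Longrightarrow> (f has_derivative f' x) (at x)"
    and "\<And>v. Ck_on k (\<lambda>x. f' x v) S"
  shows "Ck_on (Suc k) f S"
proof -
  have "Ck_on k (\<lambda>x. frechet_derivative f (at x) v) S" for v
    by (rule Ck_on_cong[OF assms(3)[of v] assms(1)]) (simp add: frechet_derivative_at[OF assms(2)])
  moreover have "f differentiable_on S"
    using assms by (auto simp: differentiable_on_eq_differentiable_at differentiable_def)
  ultimately show ?thesis by simp
qed

lemma Ck_on_Suc_imp: "Ck_on (Suc k) f S \<Longrightarrow> Ck_on k f S"
proof (induction k arbitrary: f)
  case 0
  then show ?case by (simp add: differentiable_imp_continuous_on)
next
  case (Suc k)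
  then show ?case by (metis Ck_on.simps(2))
qed

lemma Ck_on_const: "open S \<Longrightarrow> Ck_on k (\<lambda>x. c) S"
proof (induction k arbitrary: c)
  case (Suc k)
  show ?case
    by (rule Ck_on_SucI[OF \<open>open S\<close>, where f' = "\<lambda>x v. 0"]) (auto intro: Suc)
qed auto

lemma Ck_on_linear_compose:
  assumes "bounded_linear T" "open S" "Ck_on k f S"
  shows "Ck_on k (\<lambda>x. T (f x)) S"
  using assms(3)
proof (induction k arbitrary: f)
  case 0
  then show ?case
    by (auto intro: bounded_linear.continuous_on[OF assms(1)])
next
  case (Suc k)
  show ?case
  proof (rule Ck_on_SucI[OF \<open>open S\<close>])
    show "((\<lambda>x. T (f x)) has_derivative (\<lambda>v. T (frechet_derivative f (at x) v))) (at x)"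
      if "x \<in> S" for x
      by (rule bounded_linear.has_derivative[OF assms(1) Ck_on_has_derivative[OF Suc.prems \<open>open S\<close> that]])
    show "Ck_on k (\<lambda>x. T (frechet_derivative f (at x) v)) S" for v
      using Suc by auto
  qed
qed

lemma Ck_on_bounded_linear:
  assumes "bounded_linear T" "open S"
  shows "Ck_on k T S"
proof (cases k)
  case 0
  then show ?thesis using linear_continuous_on[OF assms(1)] by simp
next
  case (Suc m)
  show ?thesis unfolding Suc
    by (rule Ck_on_SucI[OF \<open>open S\<close>, where f' = "\<lambda>x. T"])
      (auto intro: bounded_linear.has_derivative[OF assms(1)] Ck_on_const assms bounded_linear_imp_has_derivative)
qed

lemma Ck_on_add:
  assumes "open S" "Ck_on k f S" "Ck_on k g S"
  shows "Ck_on k (\<lambda>x. f x + g x) S"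
  using assms(2,3)
proof (induction k arbitrary: f g)
  case 0
  then show ?case by (auto intro: continuous_intros)
next
  case (Suc k)
  show ?case
  proof (rule Ck_on_SucI[OF \<open>open S\<close>])
    show "((\<lambda>x. f x + g x) has_derivative (\<lambda>v. frechet_derivative f (at x) v + frechet_derivative g (at x) v)) (at x)"
      if "x \<in> S" for x
      by (intro has_derivative_add Ck_on_has_derivative[OF Suc.prems(1) \<open>open S\<close> that] Ck_on_has_derivative[OF Suc.prems(2) \<open>open S\<close> that])
    show "Ck_on k (\<lambda>x. frechet_derivative f (at x) v + frechet_derivative g (at x) v) S" for v
      using Suc by auto
  qed
qed

lemma Ck_on_sum:
  assumes "open S" "\<And>i. i \<in> I \<Longrightarrow> Ck_on k (f i) S"
  shows "Ck_on k (\<lambda>x. \<Sum>i\<in>I. f i x) S"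
proof (cases "finite I")
  case True
  then show ?thesis using assms(2)
    by (induction I rule: finite_induct) (auto intro: Ck_on_const Ck_on_add assms(1))
qed (simp add: Ck_on_const assms(1))

lemma Ck_on_bilinear:
  assumes "bounded_bilinear B" "open S" "Ck_on k f S" "Ck_on k g S"
  shows "Ck_on k (\<lambda>x. B (f x) (g x)) S"
  using assms(3,4)
proof (induction k arbitrary: f g)
  case 0
  then show ?case by (auto intro: bounded_bilinear.continuous_on[OF assms(1)])
next
  case (Suc k)
  show ?case
  proof (rule Ck_on_SucI[OF \<open>open S\<close>])
    show "((\<lambda>x. B (f x) (g x)) has_derivative
        (\<lambda>v. B (f x) (frechet_derivative g (at x) v) + B (frechet_derivative f (at x) v) (g x))) (at x)"
      if "x \<in> S" for x
      by (intro bounded_bilinear.FDERIV[OF assms(1)] Ck_on_has_derivative[OF Suc.prems(1) \<open>open S\<close> that] Ck_on_has_derivative[OF Suc.prems(2) \<open>open S\<close> that])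
    show "Ck_on k (\<lambda>x. B (f x) (frechet_derivative g (at x) v) + B (frechet_derivative f (at x) v) (g x)) S" for v
      using Suc.prems[THEN Ck_on_Suc_imp] Suc.prems
      by (intro Ck_on_add assms(2) Suc.IH) auto
  qed
qed

lemmas Ck_on_mult = Ck_on_bilinear[OF bounded_bilinear_mult]
lemmas Ck_on_scaleR = Ck_on_bilinear[OF bounded_bilinear_scaleR]

lemma Ck_on_power:
  fixes f :: "'a::euclidean_space \<Rightarrow> 'b::real_normed_algebra_1"
  assumes "open S" "Ck_on k f S"
  shows "Ck_on k (\<lambda>x. f x ^ n) S"
  by (induction n) (auto intro: Ck_on_const Ck_on_mult assms)

text \<open>The chain rule writes the derivative of \<open>g \<circ> f\<close> as \<open>dg (f x) (df x v)\<close>, where both the point and the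
direction vary with \<open>x\<close>. Expanding the direction in a basis leaves only derivatives of \<open>g\<close> in fixed
directions, to which the induction hypothesis applies.\<close>

lemma Ck_on_compose:
  assumes "open S" "open T" "\<And>x. x \<in> S \<Longrightarrow> f x \<in> T" "Ck_on k f S" "Ck_on k g T"
  shows "Ck_on k (\<lambda>x. g (f x)) S"
  using assms(4,5)
proof (induction k arbitrary: g)
  case 0
  then show ?case using assms(3) by (auto intro: continuous_on_compose2)
next
  case (Suc k)
  show ?case
  proof (rule Ck_on_SucI[OF \<open>open S\<close>])
    show "((\<lambda>x. g (f x)) has_derivative
        (\<lambda>v. \<Sum>b\<in>Basis. (frechet_derivative f (at x) v \<bullet> b) *\<^sub>R frechet_derivative g (at (f x)) b)) (at x)"
      if "x \<in> S" for x
    proof -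
      have df: "(f has_derivative frechet_derivative f (at x)) (at x)"
        by (rule Ck_on_has_derivative[OF Suc.prems(1) \<open>open S\<close> that])
      have dg: "(g has_derivative frechet_derivative g (at (f x))) (at (f x))"
        by (rule Ck_on_has_derivative[OF Suc.prems(2) \<open>open T\<close> assms(3)[OF that]])
      note lin = has_derivative_linear[OF dg]
      have "(\<Sum>b\<in>Basis. (w \<bullet> b) *\<^sub>R frechet_derivative g (at (f x)) b)
          = frechet_derivative g (at (f x)) (\<Sum>b\<in>Basis. (w \<bullet> b) *\<^sub>R b)" for w
        by (simp add: linear_sum[OF lin] linear_scale[OF lin])
      then have "(\<Sum>b\<in>Basis. (w \<bullet> b) *\<^sub>R frechet_derivative g (at (f x)) b) = frechet_derivative g (at (f x)) w" for w
        by (simp only: euclidean_representation)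
      with has_derivative_compose[OF df dg] show ?thesis by simp
    qed
    show "Ck_on k (\<lambda>x. \<Sum>b\<in>Basis. (frechet_derivative f (at x) v \<bullet> b) *\<^sub>R frechet_derivative g (at (f x)) b) S" for v
    proof (intro Ck_on_sum Ck_on_scaleR assms(1) Suc.IH)
      show "Ck_on k (\<lambda>x. frechet_derivative f (at x) v \<bullet> b) S" for b
        using Suc.prems by (intro Ck_on_linear_compose[OF bounded_linear_inner_left] assms) auto
    qed (use Suc.prems Ck_on_Suc_imp in auto)
  qed
qed

lemma Ck_on_exp: "Ck_on k (exp :: 'a::{real_normed_field,banach,euclidean_space} \<Rightarrow> 'a) UNIV"
proof (induction k)
  case 0
  then show ?case by (auto intro: continuous_intros)
next
  case (Suc k)
  show ?case
  proof (rule Ck_on_SucI)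
    show "(exp has_derivative (\<lambda>v. exp x * v)) (at x)" for x :: 'a
      using DERIV_exp[of x] by (simp add: has_field_derivative_def)
    show "Ck_on k (\<lambda>x :: 'a. exp x * v) UNIV" for v
      by (intro Ck_on_mult Ck_on_const Suc open_UNIV)
  qed auto
qed

lemma Ck_on_inverse: "Ck_on k (inverse :: 'a::{real_normed_field,euclidean_space} \<Rightarrow> 'a) (- {0})"
proof (induction k)
  case 0
  then show ?case by (auto intro!: continuous_intros)
next
  case (Suc k)
  show ?case
  proof (rule Ck_on_SucI)
    show "(inverse has_derivative (\<lambda>v. (inverse x * inverse x) * (- v))) (at x)"
      if "x \<in> - {0}" for x :: 'a
      using that by (auto intro!: derivative_eq_intros)
    show "Ck_on k (\<lambda>x :: 'a. (inverse x * inverse x) * (- v)) (- {0})" for v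
      by (intro Ck_on_mult Ck_on_const Suc open_delete) auto
  qed auto
qed

lemma bounded_linear_axis: "bounded_linear (axis i :: 'b::euclidean_space \<Rightarrow> 'b^'n)"
  unfolding linear_conv_bounded_linear[symmetric]
  by (auto intro!: linearI simp: axis_def vec_eq_iff)

lemma vec_eq_sum_axis: "x = (\<Sum>i\<in>UNIV. axis i (x $ i))" for x :: "'b::euclidean_space^'n"
proof (rule vec_eq_iff[THEN iffD2], intro allI)
  fix j
  have "(\<Sum>i\<in>UNIV. axis i (x $ i)) $ j = (\<Sum>i\<in>UNIV. if j = i then x $ i else 0)"
    unfolding sum_component by (intro sum.cong) (auto simp: axis_def)
  then show "x $ j = (\<Sum>i\<in>UNIV. axis i (x $ i)) $ j"
    by simp
qed

lemma Ck_on_vec: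
  fixes f :: "'a::euclidean_space \<Rightarrow> 'b::euclidean_space^'n"
  assumes "open S" "\<And>i. Ck_on k (\<lambda>x. f x $ i) S"
  shows "Ck_on k f S"
proof -
  have "Ck_on k (\<lambda>x. \<Sum>i\<in>UNIV. axis i (f x $ i)) S"
    by (intro Ck_on_sum Ck_on_linear_compose[OF bounded_linear_axis] assms)
  then show ?thesis
    by (simp only: vec_eq_sum_axis[symmetric])
qed

lemma has_derivative_vec:
  fixes f :: "'a::euclidean_space \<Rightarrow> 'b::euclidean_space^'n"
  assumes "\<And>i. ((\<lambda>x. f x $ i) has_derivative (\<lambda>v. f' v $ i)) F"
  shows "(f has_derivative f') F"
proof -
  have "((\<lambda>x. \<Sum>i\<in>UNIV. axis i (f x $ i)) has_derivative (\<lambda>v. \<Sum>i\<in>UNIV. axis i (f' v $ i))) F"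
    by (intro has_derivative_sum bounded_linear.has_derivative[OF bounded_linear_axis] assms)
  then show ?thesis
    by (simp only: vec_eq_sum_axis[symmetric])
qed

lemmas Ck_on_fst = Ck_on_linear_compose[OF bounded_linear_fst]
lemmas Ck_on_snd = Ck_on_linear_compose[OF bounded_linear_snd]
lemmas Ck_on_Re = Ck_on_linear_compose[OF bounded_linear_Re]
lemmas Ck_on_of_real = Ck_on_linear_compose[OF bounded_linear_of_real]
lemmas Ck_on_nth = Ck_on_linear_compose[OF bounded_linear_vec_nth]

lemma Ck_on_exp_compose:
  fixes f :: "'a::euclidean_space \<Rightarrow> 'b::{real_normed_field,banach,euclidean_space}"
  shows "open S \<Longrightarrow> Ck_on k f S \<Longrightarrow> Ck_on k (\<lambda>x. exp (f x)) S"
  by (rule Ck_on_compose[OF _ open_UNIV _ _ Ck_on_exp]) auto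

lemma Ck_on_Pair:
  fixes f :: "'a::euclidean_space \<Rightarrow> 'b::euclidean_space" and g :: "'a \<Rightarrow> 'c::euclidean_space"
  assumes "open S" "Ck_on k f S" "Ck_on k g S"
  shows "Ck_on k (\<lambda>x. (f x, g x)) S"
proof -
  have L: "bounded_linear (\<lambda>y. (y, 0 :: 'c))" "bounded_linear (\<lambda>y. (0 :: 'b, y))"
    by (auto intro!: bounded_linear_Pair bounded_linear_ident bounded_linear_zero)
  show ?thesis
    using Ck_on_add[OF assms(1) Ck_on_linear_compose[OF L(1) assms(1,2)] Ck_on_linear_compose[OF L(2) assms(1,3)]]
    by simp
qed

section \<open>Mean curvature and Lagrangian tangent frames\<close>

lemma linear_eq_sum_pderiv_vec:
  assumes "linear (frechet_derivative f (at u))"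
  shows "frechet_derivative f (at u) v = (\<Sum>i\<in>UNIV. v $ i *\<^sub>R pderiv_vec i f u)"
proof -
  have "frechet_derivative f (at u) v = frechet_derivative f (at u) (\<Sum>i\<in>UNIV. v $ i *\<^sub>R axis i 1)"
    using basis_expansion[of v] by (simp add: scalar_mult_eq_scaleR)
  also have "\<dots> = (\<Sum>i\<in>UNIV. v $ i *\<^sub>R pderiv_vec i f u)"
    unfolding pderiv_vec_def by (simp add: linear_sum[OF assms] linear_scale[OF assms])
  finally show ?thesis .
qed

lemma pderiv_vec_in_range: "pderiv_vec i f u \<in> range (frechet_derivative f (at u))"
  by (simp add: pderiv_vec_def)

lemma orthogonal_range_iff:
  assumes "linear (frechet_derivative f (at u))"
  shows "(\<forall>v. \<nu> \<bullet> frechet_derivative f (at u) v = 0) \<longleftrightarrow> (\<forall>i. \<nu> \<bullet> pderiv_vec i f u = 0)"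
proof
  assume "\<forall>i. \<nu> \<bullet> pderiv_vec i f u = 0"
  then show "\<forall>v. \<nu> \<bullet> frechet_derivative f (at u) v = 0"
    by (simp add: linear_eq_sum_pderiv_vec[OF assms] inner_sum_right)
qed (simp add: pderiv_vec_def)

lemma induced_metric_nth: "induced_metric f u $ i $ j = pderiv_vec i f u \<bullet> pderiv_vec j f u"
  by (simp add: induced_metric_def)

lemma induced_metric_inverse:
  assumes lin: "linear (frechet_derivative f (at u))" and inj: "inj (frechet_derivative f (at u))"
  shows "matrix_inv (induced_metric f u) ** induced_metric f u = mat 1"
    and "induced_metric f u ** matrix_inv (induced_metric f u) = mat 1"
proof -
  let ?D = "frechet_derivative f (at u)" and ?g = "induced_metric f u"
  have "v = 0" if "?g *v v = 0" for v
  proof -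
    have "(?g *v v) $ i = pderiv_vec i f u \<bullet> ?D v" for i
      by (simp add: linear_eq_sum_pderiv_vec[OF lin] matrix_vector_mult_def induced_metric_nth inner_sum_right mult.commute)
    then have "?D v \<bullet> pderiv_vec i f u = 0" for i
      using that by (simp add: inner_commute)
    then have "?D v \<bullet> ?D v = 0"
      using orthogonal_range_iff[OF lin] by blast
    then show "v = 0"
      using linear_injective_0[OF lin] inj by simp
  qed
  then have "invertible ?g"
    using invertible_left_inverse matrix_left_invertible_ker by blast
  then have "?g ** matrix_inv ?g = mat 1 \<and> matrix_inv ?g ** ?g = mat 1"
    unfolding invertible_def matrix_inv_def by (rule someI_ex)
  then show "matrix_inv ?g ** ?g = mat 1" "?g ** matrix_inv ?g = mat 1"
    by auto
qed

text \<open>The tangent and normal parts of a vector are unique because a vector that is both tangent and normal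
is orthogonal to itself; this discharges the definite description.\<close>

lemma normal_component_eqI:
  assumes lin: "linear (frechet_derivative f (at u))"
    and "w - \<nu> \<in> range (frechet_derivative f (at u))"
    and "\<And>v. \<nu> \<bullet> frechet_derivative f (at u) v = 0"
  shows "normal_component f u w = \<nu>"
  unfolding normal_component_def
proof (rule the_equality)
  fix \<mu>
  let ?D = "frechet_derivative f (at u)"
  assume "w - \<mu> \<in> range ?D \<and> (\<forall>v. \<mu> \<bullet> ?D v = 0)"
  then obtain a b where ab: "w - \<mu> = ?D a" "w - \<nu> = ?D b" and m: "\<forall>v. \<mu> \<bullet> ?D v = 0"
    using assms by auto
  then have "\<nu> - \<mu> = ?D (a - b)"
    by (simp add: linear_diff[OF lin] algebra_simps flip: ab)
  then have "(\<nu> - \<mu>) \<bullet> (\<nu> - \<mu>) = 0"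
    using assms(3) m by (metis inner_diff_left diff_zero)
  then show "\<mu> = \<nu>" by simp
qed (use assms in auto)

text \<open>The orthogonal projection onto the span of a frame, written with the inverse Gram matrix. The formula
supplies existence of the normal component and exhibits it as linear in \<open>w\<close>.\<close>

lemma normal_component_eq:
  assumes lin: "linear (frechet_derivative f (at u))" and inj: "inj (frechet_derivative f (at u))"
  shows "normal_component f u w =
    w - (\<Sum>i\<in>UNIV. \<Sum>j\<in>UNIV. (matrix_inv (induced_metric f u) $ i $ j * (w \<bullet> pderiv_vec j f u)) *\<^sub>R pderiv_vec i f u)"
    (is "_ = w - ?P")
proof (rule normal_component_eqI[OF lin])
  let ?D = "frechet_derivative f (at u)" and ?g = "induced_metric f u"
  have "subspace (range ?D)" by (simp add: lin linear_subspace_image)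
  then have "?P \<in> range ?D"
    by (intro subspace_sum subspace_scale pderiv_vec_in_range)
  then show "w - (w - ?P) \<in> range ?D" by simp
  have "(w - ?P) \<bullet> pderiv_vec m f u = 0" for m
  proof -
    have "?P \<bullet> pderiv_vec m f u = (\<Sum>j\<in>UNIV. \<Sum>i\<in>UNIV. ?g $ m $ i * matrix_inv ?g $ i $ j * (w \<bullet> pderiv_vec j f u))"
      unfolding inner_sum_left
      by (subst sum.swap) (simp add: induced_metric_nth inner_commute mult_ac)
    also have "\<dots> = (\<Sum>j\<in>UNIV. (?g ** matrix_inv ?g) $ m $ j * (w \<bullet> pderiv_vec j f u))"
      by (simp add: matrix_matrix_mult_def sum_distrib_right)
    also have "\<dots> = w \<bullet> pderiv_vec m f u"
      by (simp add: induced_metric_inverse(2)[OF lin inj] mat_def if_distrib[of "\<lambda>x. x * _"] cong: if_cong)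
    finally show ?thesis by (simp add: inner_diff_left)
  qed
  then show "(w - ?P) \<bullet> ?D v = 0" for v
    using orthogonal_range_iff[OF lin] by blast
qed

text \<open>By linearity of the normal component the trace may be taken first, over the raw second derivatives;
then only one vector has to be split into tangent and normal part.\<close>

lemma mean_curvature_vector_eqI:
  assumes lin: "linear (frechet_derivative f (at u))" and inj: "inj (frechet_derivative f (at u))"
    and tang: "(\<Sum>i\<in>UNIV. \<Sum>j\<in>UNIV. matrix_inv (induced_metric f u) $ i $ j *\<^sub>R pderiv_vec i (pderiv_vec j f) u) - \<nu>
          \<in> range (frechet_derivative f (at u))"
    and norm: "\<And>v. \<nu> \<bullet> frechet_derivative f (at u) v = 0"
  shows "mean_curvature_vector f u = \<nu>"
proof -
  let ?P = "\<lambda>w. \<Sum>i\<in>UNIV. \<Sum>j\<in>UNIV. (matrix_inv (induced_metric f u) $ i $ j * (w \<bullet> pderiv_vec j f u)) *\<^sub>R pderiv_vec i f u"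
  have "linear (\<lambda>w. w - ?P w)"
    by (intro linear_compose_sub linear_compose_sum ballI linear_ident linearI)
      (auto simp: inner_add_left algebra_simps)
  moreover have "normal_component f u = (\<lambda>w. w - ?P w)"
    using normal_component_eq[OF lin inj] by blast
  ultimately have L: "linear (normal_component f u)" by simp
  have "mean_curvature_vector f u = normal_component f u
     (\<Sum>i\<in>UNIV. \<Sum>j\<in>UNIV. matrix_inv (induced_metric f u) $ i $ j *\<^sub>R pderiv_vec i (pderiv_vec j f) u)"
    unfolding mean_curvature_vector_def second_fundamental_form_def
    by (simp add: linear_sum[OF L] linear_scale[OF L])
  also have "\<dots> = \<nu>"
    by (rule normal_component_eqI[OF lin tang norm])
  finally show ?thesis .
qed

text \<open>Metric and Kaehler form are, up to sign, the real and imaginary parts of the Hermitian product, so on a Lagrangian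
subspace the Hermitian product is real.\<close>

lemma hermitian_eq:
  fixes v w :: "complex^'m"
  shows "(\<Sum>k\<in>UNIV. v $ k * cnj (w $ k)) = Complex (v \<bullet> w) (- kaehler_form v w)"
  by (simp add: complex_eq_iff inner_vec_def inner_complex_def kaehler_form_def cplx_structure_def
      sum_negf[symmetric] algebra_simps)

text \<open>Let the columns of the square complex matrix \<open>J\<close> be the frame. The Lagrangian condition makes the
Gram matrix \<open>J\<^sup>* J\<close> equal to the real matrix \<open>g\<close>, so \<open>g\<close> inverse times \<open>J\<^sup>*\<close> is a left inverse of \<open>J\<close>.
Because \<open>J\<close> is square, it is also a right inverse, which is the assertion.\<close>

lemma lagrangian_frame_complete:
  fixes f :: "real^'m \<Rightarrow> complex^'m"
  assumes lin: "linear (frechet_derivative f (at u))" and inj: "inj (frechet_derivative f (at u))"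
    and lag: "\<And>i j. kaehler_form (pderiv_vec i f u) (pderiv_vec j f u) = 0"
  shows "(\<Sum>i\<in>UNIV. \<Sum>j\<in>UNIV. of_real (matrix_inv (induced_metric f u) $ i $ j) *
      (pderiv_vec i f u $ k * cnj (pderiv_vec j f u $ l))) = (if k = l then 1 else 0)"
proof -
  let ?g = "induced_metric f u"
  define J :: "complex^'m^'m" where "J = (\<chi> k i. pderiv_vec i f u $ k)"
  define K :: "complex^'m^'m" where
    "K = (\<chi> i k. \<Sum>j\<in>UNIV. of_real (matrix_inv ?g $ i $ j) * cnj (pderiv_vec j f u $ k))"
  have "(K ** J) $ i $ l = mat 1 $ i $ l" for i l
  proof -
    have "(K ** J) $ i $ l = (\<Sum>j\<in>UNIV. of_real (matrix_inv ?g $ i $ j) *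
        (\<Sum>k\<in>UNIV. pderiv_vec l f u $ k * cnj (pderiv_vec j f u $ k)))"
      unfolding K_def J_def
      by (simp add: matrix_matrix_mult_def sum_distrib_left sum_distrib_right mult_ac) (rule sum.swap)
    also have "\<dots> = of_real ((matrix_inv ?g ** ?g) $ i $ l)"
      by (simp add: hermitian_eq lag complex_eq_iff matrix_matrix_mult_def induced_metric_nth inner_commute)
    also have "\<dots> = mat 1 $ i $ l"
      by (simp add: induced_metric_inverse(1)[OF lin inj] mat_def)
    finally show ?thesis .
  qed
  then have "K ** J = mat 1" by (simp add: vec_eq_iff)
  then have "J ** K = mat 1" by (simp add: matrix_left_right_inverse)
  then have "(J ** K) $ k $ l = (if k = l then 1 else 0)" by (simp add: mat_def)
  then show ?thesis
    by (simp add: J_def K_def matrix_matrix_mult_def sum_distrib_left mult_ac)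
qed

text \<open>A Lagrangian subspace is its own symplectic complement: the coefficients of \<open>x\<close> in the complex
basis of the preceding lemma are built from the Hermitian products of \<open>x\<close> with the frame, and these
are real by hypothesis.\<close>

lemma lagrangian_tangentI:
  fixes f :: "real^'m \<Rightarrow> complex^'m"
  assumes lin: "linear (frechet_derivative f (at u))" and inj: "inj (frechet_derivative f (at u))"
    and lag: "\<And>i j. kaehler_form (pderiv_vec i f u) (pderiv_vec j f u) = 0"
    and x: "\<And>j. kaehler_form x (pderiv_vec j f u) = 0"
  shows "x \<in> range (frechet_derivative f (at u))"
proof -
  let ?gi = "matrix_inv (induced_metric f u)"
  have "x $ k = (\<Sum>i\<in>UNIV. \<Sum>j\<in>UNIV. (?gi $ i $ j * (x \<bullet> pderiv_vec j f u)) *\<^sub>R pderiv_vec i f u) $ k" for k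
  proof -
    have "x $ k = (\<Sum>l\<in>UNIV. (if k = l then 1 else 0) * x $ l)"
      by (simp add: if_distrib[of "\<lambda>y. y * _"] cong: if_cong)
    also have "\<dots> = (\<Sum>l\<in>UNIV. (\<Sum>i\<in>UNIV. \<Sum>j\<in>UNIV. of_real (?gi $ i $ j) *
      (pderiv_vec i f u $ k * cnj (pderiv_vec j f u $ l))) * x $ l)"
      by (simp only: lagrangian_frame_complete[OF lin inj lag])
    also have "\<dots> = (\<Sum>l\<in>UNIV. \<Sum>i\<in>UNIV. \<Sum>j\<in>UNIV. of_real (?gi $ i $ j) * pderiv_vec i f u $ k *
      (x $ l * cnj (pderiv_vec j f u $ l)))"
      by (simp add: sum_distrib_right sum_distrib_left mult_ac)
    also have "\<dots> = (\<Sum>i\<in>UNIV. \<Sum>j\<in>UNIV. \<Sum>l\<in>UNIV. of_real (?gi $ i $ j) * pderiv_vec i f u $ k *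
      (x $ l * cnj (pderiv_vec j f u $ l)))"
      by (subst sum.swap, rule sum.cong[OF refl], rule sum.swap)
    also have "\<dots> = (\<Sum>i\<in>UNIV. \<Sum>j\<in>UNIV. of_real (?gi $ i $ j) * pderiv_vec i f u $ k * of_real (x \<bullet> pderiv_vec j f u))"
      unfolding sum_distrib_left[symmetric] hermitian_eq x by (simp add: complex_of_real_def)
    finally show ?thesis
      by (simp add: scaleR_conv_of_real[where 'a = complex] mult_ac)
  qed
  then have "x = (\<Sum>i\<in>UNIV. \<Sum>j\<in>UNIV. (?gi $ i $ j * (x \<bullet> pderiv_vec j f u)) *\<^sub>R pderiv_vec i f u)"
    by (simp add: vec_eq_iff)
  moreover have "subspace (range (frechet_derivative f (at u)))" by (simp add: lin linear_subspace_image)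
  ultimately show ?thesis
    by (metis (no_types, lifting) subspace_sum subspace_scale pderiv_vec_in_range)
qed

section \<open>Mean curvature of an orbit sweep of a real hypersurface\<close>

lemma kaehler_form_eq_sum:
  fixes v w :: "complex^'m"
  shows "kaehler_form v w = - (\<Sum>k\<in>UNIV. Im (v $ k * cnj (w $ k)))"
  using arg_cong[OF hermitian_eq[of v w], of Im] by simp

lemma inner_eq_sum:
  fixes v w :: "complex^'m"
  shows "v \<bullet> w = (\<Sum>k\<in>UNIV. Re (v $ k * cnj (w $ k)))"
  using arg_cong[OF hermitian_eq[of v w], of Re] by simp

text \<open>The immersion is the image of a real map \<open>X\<close> under the one-parameter group with weights \<open>l\<close> and
translation \<open>\<i> d\<close>, with group parameter \<open>h\<close>. Translated coordinates do not rotate (\<open>l k * d k = 0\<close>),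
so the action is free as soon as one coordinate is translated. The hypothesis on the derivative of
\<open>X\<close> says that \<open>X\<close> moves in a level set of the moment map, whose gradient on real points is the
vector \<open>n\<close> introduced below.\<close>

locale equivariant_map =
  fixes U :: "(real^'m) set" and X :: "'m \<Rightarrow> real^'m \<Rightarrow> real" and h :: "real^'m \<Rightarrow> real"
    and l d :: "'m \<Rightarrow> real" and f :: "real^'m \<Rightarrow> complex^'m" and k0 :: 'm
  assumes open_U: "open U"
    and CX: "\<And>k. Ck_on 2 (X k) U" and Ch: "Ck_on 2 h U"
    and ld: "\<And>k. l k * d k = 0" and dk0: "d k0 \<noteq> 0"
    and f_eq: "\<And>v k. v \<in> U \<Longrightarrow> f v $ k = of_real (X k v) * exp (\<i> * of_real (l k * h v)) + \<i> * of_real (d k * h v)"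
    and level: "\<And>v w. v \<in> U \<Longrightarrow> (\<Sum>k\<in>UNIV. (l k * X k v + d k) * frechet_derivative (X k) (at v) w) = 0"
    and Xh_immersive: "\<And>v w. v \<in> U \<Longrightarrow> (\<And>k. frechet_derivative (X k) (at v) w = 0) \<Longrightarrow>
        frechet_derivative h (at v) w = 0 \<Longrightarrow> w = 0"
begin

definition n :: "'m \<Rightarrow> real^'m \<Rightarrow> real" where "n k v = l k * X k v + d k"
definition E :: "'m \<Rightarrow> real^'m \<Rightarrow> complex" where "E k v = exp (\<i> * of_real (l k * h v))"

text \<open>This identity lets the rotation factor \<open>E\<close> be pulled out of the translation part as well, so that the
derivative of \<open>f\<close> is a unitary diagonal matrix applied to \<open>dX + \<i> dh n\<close>.\<close>

lemma d_E: "of_real (d k) * E k v = of_real (d k)"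
  using ld[of k] by (auto simp: E_def)

lemma E_cnj: "E k v * cnj (E k v) = 1"
  unfolding complex_norm_square[symmetric] by (simp add: E_def)

lemma E_herm: "(E k v * a) * cnj (E k v * b) = a * cnj b"
proof -
  have "(E k v * a) * cnj (E k v * b) = (E k v * cnj (E k v)) * (a * cnj b)" by simp
  then show ?thesis by (simp only: E_cnj mult_1_left)
qed

lemma dX: "v \<in> U \<Longrightarrow> (X k has_derivative frechet_derivative (X k) (at v)) (at v)"
  and dh: "v \<in> U \<Longrightarrow> (h has_derivative frechet_derivative h (at v)) (at v)"
  using CX[of k] Ch open_U unfolding numeral_2_eq_2 by (blast intro: Ck_on_has_derivative)+

lemma dE: "v \<in> U \<Longrightarrow> (E k has_derivative (\<lambda>w. E k v * (\<i> * of_real (l k * frechet_derivative h (at v) w)))) (at v)"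
  unfolding E_def
  by (rule has_derivative_compose[where g = exp, OF _ DERIV_exp[unfolded has_field_derivative_def]])
    (auto intro!: derivative_eq_intros has_derivative_of_real dh)

lemma dn: "v \<in> U \<Longrightarrow> (n k has_derivative (\<lambda>w. l k * frechet_derivative (X k) (at v) w)) (at v)"
  unfolding n_def by (auto intro!: derivative_eq_intros dX)

lemma ddX: "v \<in> U \<Longrightarrow> (pderiv_vec j (X k) has_derivative frechet_derivative (pderiv_vec j (X k)) (at v)) (at v)"
  and ddh: "v \<in> U \<Longrightarrow> (pderiv_vec j h has_derivative frechet_derivative (pderiv_vec j h) (at v)) (at v)"
proof -
  have "Ck_on (Suc 0) (pderiv_vec j (X k)) U" "Ck_on (Suc 0) (pderiv_vec j h) U"
    using CX[of k] Ch by (simp_all add: numeral_2_eq_2 pderiv_vec_def[abs_def])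
  then show "v \<in> U \<Longrightarrow> (pderiv_vec j (X k) has_derivative frechet_derivative (pderiv_vec j (X k)) (at v)) (at v)"
     "v \<in> U \<Longrightarrow> (pderiv_vec j h has_derivative frechet_derivative (pderiv_vec j h) (at v)) (at v)"
    using Ck_on_has_derivative open_U by blast+
qed

lemma df:
  assumes "v \<in> U"
  shows "(f has_derivative (\<lambda>w. \<chi> k. E k v * Complex (frechet_derivative (X k) (at v) w) (n k v * frechet_derivative h (at v) w))) (at v)"
proof (rule has_derivative_vec)
  fix k
  have "((\<lambda>v. of_real (X k v) * E k v + \<i> * of_real (d k * h v)) has_derivative
      (\<lambda>w. of_real (X k v) * (E k v * (\<i> * of_real (l k * frechet_derivative h (at v) w)))
         + of_real (frechet_derivative (X k) (at v) w) * E k v + \<i> * of_real (d k * frechet_derivative h (at v) w))) (at v)"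
    (is "(_ has_derivative ?D) _")
    by (auto intro!: derivative_eq_intros has_derivative_of_real dh dX dE assms)
  moreover have "?D = (\<lambda>w. (\<chi> k. E k v * Complex (frechet_derivative (X k) (at v) w) (n k v * frechet_derivative h (at v) w)) $ k)"
    (is "_ = ?D'")
  proof
    fix w
    let ?x = "frechet_derivative (X k) (at v) w" and ?y = "frechet_derivative h (at v) w"
    have "?D w = E k v * (of_real ?x + \<i> * of_real (l k * X k v * ?y)) + \<i> * (of_real (d k) * E k v) * of_real ?y"
      by (simp add: d_E algebra_simps)
    also have "\<dots> = ?D' w"
      by (simp add: n_def Complex_eq algebra_simps)
    finally show "?D w = ?D' w" .
  qed
  ultimately have D: "((\<lambda>v. of_real (X k v) * E k v + \<i> * of_real (d k * h v)) has_derivative ?D') (at v)"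
    by simp
  show "((\<lambda>x. f x $ k) has_derivative ?D') (at v)"
    by (rule has_derivative_transform_within_open[OF D open_U assms]) (simp add: f_eq E_def)
qed

lemma frechet_f: "v \<in> U \<Longrightarrow> frechet_derivative f (at v) w $ k =
    E k v * Complex (frechet_derivative (X k) (at v) w) (n k v * frechet_derivative h (at v) w)"
  by (simp add: frechet_derivative_at[OF df, symmetric])

lemma pderiv_f: "v \<in> U \<Longrightarrow> pderiv_vec j f v $ k =
    E k v * Complex (pderiv_vec j (X k) v) (n k v * pderiv_vec j h v)"
  by (simp add: pderiv_vec_def frechet_f)

lemma linear_f: "v \<in> U \<Longrightarrow> linear (frechet_derivative f (at v))"
  by (simp add: has_derivative_linear[OF df] frechet_derivative_at[OF df, symmetric])

lemma imm:
  assumes v: "v \<in> U"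
  shows "inj (frechet_derivative f (at v))"
  unfolding linear_injective_0[OF linear_f[OF v]]
proof (intro allI impI)
  fix w
  assume "frechet_derivative f (at v) w = 0"
  then have "E k v * Complex (frechet_derivative (X k) (at v) w) (n k v * frechet_derivative h (at v) w) = 0" for k
    by (simp flip: frechet_f[OF v])
  then have *: "frechet_derivative (X k) (at v) w = 0 \<and> n k v * frechet_derivative h (at v) w = 0" for k
    using mult_eq_0_iff[of "E k v"] E_cnj[of k v] by (metis Complex_eq_0 mult_zero_left zero_neq_one)
  moreover have "n k0 v \<noteq> 0"
    using dk0 ld[of k0] by (simp add: n_def)
  ultimately show "w = 0"
    using Xh_immersive[OF v] mult_eq_0_iff by blast
qed

lemma lagrangian: "v \<in> U \<Longrightarrow> kaehler_form (frechet_derivative f (at v) w) (frechet_derivative f (at v) w') = 0"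
  using level[of v w] level[of v w']
  by (simp only: kaehler_form_eq_sum frechet_f E_herm flip: n_def)
    (simp add: sum.distrib sum_subtractf sum_distrib_left[symmetric] mult_ac)

lemma pderiv_pderiv_f:
  assumes v: "v \<in> U"
  shows "pderiv_vec i (pderiv_vec j f) v $ k = E k v *
     Complex (pderiv_vec i (pderiv_vec j (X k)) v - l k * n k v * (pderiv_vec i h v * pderiv_vec j h v))
       (n k v * pderiv_vec i (pderiv_vec j h) v
         + l k * (pderiv_vec i h v * pderiv_vec j (X k) v + pderiv_vec i (X k) v * pderiv_vec j h v))"
proof -
  let ?D = "\<lambda>w. \<chi> k. E k v * (of_real (frechet_derivative (pderiv_vec j (X k)) (at v) w)
      + \<i> * of_real (n k v * frechet_derivative (pderiv_vec j h) (at v) w + l k * frechet_derivative (X k) (at v) w * pderiv_vec j h v))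
      + E k v * (\<i> * of_real (l k * frechet_derivative h (at v) w)) * (of_real (pderiv_vec j (X k) v) + \<i> * of_real (n k v * pderiv_vec j h v))"
  have "((\<lambda>v. \<chi> k. E k v * (of_real (pderiv_vec j (X k) v) + \<i> * of_real (n k v * pderiv_vec j h v))) has_derivative ?D) (at v)"
    unfolding of_real_mult of_real_add
    by (rule has_derivative_vec)
      (auto intro!: derivative_eq_intros has_derivative_of_real dE[OF v] dn[OF v] ddX[OF v] ddh[OF v] simp: algebra_simps)
  then have "(pderiv_vec j f has_derivative ?D) (at v)"
    by (rule has_derivative_transform_within_open[OF _ open_U v])
      (simp add: vec_eq_iff pderiv_f Complex_eq)
  then have "pderiv_vec i (pderiv_vec j f) v = ?D (axis i 1)"
    by (simp add: pderiv_vec_def frechet_derivative_at[symmetric])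
  then show ?thesis
    by (simp add: pderiv_vec_def Complex_eq algebra_simps)
qed

lemma level_pderiv:
  assumes v: "v \<in> U"
  shows "(\<Sum>k\<in>UNIV. n k v * pderiv_vec j (X k) v) = 0"
  using level[OF v] by (simp add: pderiv_vec_def n_def)

text \<open>The product rule for \<open>\<langle>n, \<partial>\<^sub>j X\<rangle> = 0\<close>, using that \<open>\<partial>\<^sub>i n = \<Lambda> \<partial>\<^sub>i X\<close>. It trades the normal part of the second
derivative of \<open>X\<close> for a quadratic expression in its first derivative.\<close>

lemma level_pderiv_pderiv:
  assumes v: "v \<in> U"
  shows "(\<Sum>k\<in>UNIV. n k v * pderiv_vec i (pderiv_vec j (X k)) v + l k * (pderiv_vec i (X k) v * pderiv_vec j (X k) v)) = 0"
proof -
  let ?D = "\<lambda>w. \<Sum>k\<in>UNIV. n k v * frechet_derivative (pderiv_vec j (X k)) (at v) w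
      + l k * frechet_derivative (X k) (at v) w * pderiv_vec j (X k) v"
  have "((\<lambda>v. \<Sum>k\<in>UNIV. n k v * pderiv_vec j (X k) v) has_derivative ?D) (at v)"
    by (auto intro!: derivative_eq_intros dn[OF v] ddX[OF v])
  then have "((\<lambda>v. 0) has_derivative ?D) (at v)"
    by (rule has_derivative_transform_within_open[OF _ open_U v]) (simp add: level_pderiv)
  then have "?D = (\<lambda>w. 0)"
    by (rule has_derivative_unique) (auto intro: derivative_intros)
  from fun_cong[OF this, of "axis i 1"] show ?thesis
    by (simp add: pderiv_vec_def mult.assoc)
qed

text \<open>Below, \<open>T\<close> is the trace with respect to the induced metric, and \<open>x i k\<close>, \<open>y i\<close> are the partial
derivatives of \<open>X k\<close> and \<open>h\<close>. The completeness of the frame, with the unitary factors cancelled, becomes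
two real identities: its diagonal real part evaluates the trace of \<open>\<Lambda>\<close> against the tangent space, and
its imaginary part kills the mixed traces of \<open>y\<close> with \<open>x\<close>.\<close>

lemma mean_curvature:
  assumes u: "u \<in> U"
  shows "mean_curvature_vector f u $ k =
    E k u * of_real (- (\<Sum>k\<in>UNIV. l k) / (\<Sum>k\<in>UNIV. (n k u)\<^sup>2) * n k u)"
proof -
  let ?gi = "matrix_inv (induced_metric f u)"
  define T where "T q = (\<Sum>i\<in>UNIV. \<Sum>j\<in>UNIV. ?gi $ i $ j * q i j)" for q :: "'m \<Rightarrow> 'm \<Rightarrow> real"
  define x where "x i k = pderiv_vec i (X k) u" for i k
  define y where "y i = pderiv_vec i h u" for i
  define N where "N = (\<Sum>k\<in>UNIV. (n k u)\<^sup>2)"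
  have T_add: "T (\<lambda>i j. p i j + q i j) = T p + T q" for p q
    by (simp add: T_def sum.distrib distrib_left)
  have T_diff: "T (\<lambda>i j. p i j - q i j) = T p - T q" for p q
    by (simp add: T_def sum_subtractf right_diff_distrib)
  have T_mult: "T (\<lambda>i j. c * p i j) = c * T p" for c p
    by (simp add: T_def sum_distrib_left mult_ac)
  have T_sum: "T (\<lambda>i j. \<Sum>k\<in>UNIV. p k i j) = (\<Sum>k\<in>UNIV. T (p k))" for p :: "'m \<Rightarrow> 'm \<Rightarrow> 'm \<Rightarrow> real"
  proof -
    have "T (\<lambda>i j. \<Sum>k\<in>UNIV. p k i j) = (\<Sum>i\<in>UNIV. \<Sum>k\<in>UNIV. \<Sum>j\<in>UNIV. ?gi $ i $ j * p k i j)"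
      unfolding T_def sum_distrib_left by (intro sum.cong refl sum.swap)
    also have "\<dots> = (\<Sum>k\<in>UNIV. T (p k))"
      unfolding T_def by (rule sum.swap)
    finally show ?thesis .
  qed
  have T_complex: "(\<Sum>i\<in>UNIV. \<Sum>j\<in>UNIV. ?gi $ i $ j *\<^sub>R Complex (p i j) (q i j)) = Complex (T p) (T q)" for p q
    by (simp add: T_def complex_eq_iff)
  have n0: "(\<Sum>k\<in>UNIV. n k u * x i k) = 0" for i
    by (simp add: x_def level_pderiv u)
  have Npos: "N > 0"
  proof -
    have "n k0 u \<noteq> 0" using dk0 ld[of k0] by (simp add: n_def)
    then show ?thesis unfolding N_def by (intro sum_pos2[of _ k0]) auto
  qed
  have lag: "kaehler_form (pderiv_vec i f u) (pderiv_vec j f u) = 0" for i j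
    unfolding pderiv_vec_def by (rule lagrangian[OF u])
  have frame: "Complex (T (\<lambda>i j. x i k * x j m + (n k u * n m u) * (y i * y j)))
      (T (\<lambda>i j. n k u * (y i * x j m) - n m u * (x i k * y j))) = (if k = m then 1 else 0)" for k m
  proof -
    have "Complex (T (\<lambda>i j. x i k * x j m + (n k u * n m u) * (y i * y j)))
      (T (\<lambda>i j. n k u * (y i * x j m) - n m u * (x i k * y j))) =
      (\<Sum>i\<in>UNIV. \<Sum>j\<in>UNIV. ?gi $ i $ j *\<^sub>R (Complex (x i k) (n k u * y i) * cnj (Complex (x j m) (n m u * y j))))"
      unfolding T_complex[symmetric]
      by (intro sum.cong refl arg_cong2[where f = scaleR]) (simp add: complex_eq_iff)
    also have "\<dots> = cnj (E k u) * E m u * (\<Sum>i\<in>UNIV. \<Sum>j\<in>UNIV. of_real (?gi $ i $ j) *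
         (pderiv_vec i f u $ k * cnj (pderiv_vec j f u $ m)))"
      unfolding sum_distrib_left
    proof (intro sum.cong refl)
      fix i j
      have "of_real (?gi $ i $ j) * (Complex (x i k) (n k u * y i) * cnj (Complex (x j m) (n m u * y j)))
        = (E k u * cnj (E k u)) * (E m u * cnj (E m u)) *
           (of_real (?gi $ i $ j) * (Complex (x i k) (n k u * y i) * cnj (Complex (x j m) (n m u * y j))))"
        by (simp only: E_cnj mult_1_left)
      then show "?gi $ i $ j *\<^sub>R (Complex (x i k) (n k u * y i) * cnj (Complex (x j m) (n m u * y j)))
        = cnj (E k u) * E m u * (of_real (?gi $ i $ j) * (pderiv_vec i f u $ k * cnj (pderiv_vec j f u $ m)))"
        unfolding pderiv_f[OF u] scaleR_conv_of_real x_def y_def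
        by (simp only: complex_cnj_mult mult_ac)
    qed
    also have "\<dots> = (if k = m then 1 else 0)"
      unfolding lagrangian_frame_complete[OF linear_f[OF u] imm[OF u] lag]
      using E_cnj[of m u] by (simp add: mult.commute)
    finally show ?thesis .
  qed
  have frame_Re: "T (\<lambda>i j. x i k * x j k) + (n k u)\<^sup>2 * T (\<lambda>i j. y i * y j) = 1" for k
    using arg_cong[OF frame[of k k], of Re] by (simp add: T_add T_mult power2_eq_square)
  have frame_Im: "n k u * T (\<lambda>i j. y i * x j m) = n m u * T (\<lambda>i j. x i k * y j)" for k m
    using arg_cong[OF frame[of k m], of Im] by (simp add: T_diff T_mult split: if_splits)
  \<comment> \<open>Pairing the imaginary part with \<open>n\<close> in the index of \<open>x j m\<close> leaves only the other mixed trace, as \<open>x\<close> is orthogonal to \<open>n\<close>.\<close>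
  have "N * T (\<lambda>i j. x i k * y j) = 0" for k
  proof -
    have "N * T (\<lambda>i j. x i k * y j) = (\<Sum>m\<in>UNIV. n m u * (n m u * T (\<lambda>i j. x i k * y j)))"
      by (simp add: N_def power2_eq_square sum_distrib_right mult.assoc)
    also have "\<dots> = n k u * T (\<lambda>i j. \<Sum>m\<in>UNIV. n m u * (y i * x j m))"
      unfolding frame_Im[symmetric] T_sum T_mult by (simp add: sum_distrib_left mult_ac)
    also have "(\<lambda>i j. \<Sum>m\<in>UNIV. n m u * (y i * x j m)) = (\<lambda>i j. y i * (\<Sum>m\<in>UNIV. n m u * x j m))"
      by (simp add: sum_distrib_left mult_ac)
    finally show ?thesis by (simp add: n0 T_def)
  qed
  then have mixed1: "T (\<lambda>i j. x i k * y j) = 0" for k using Npos by simp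
  have "N * T (\<lambda>i j. y i * x j m) = 0" for m
  proof -
    have "N * T (\<lambda>i j. y i * x j m) = (\<Sum>k\<in>UNIV. n k u * (n k u * T (\<lambda>i j. y i * x j m)))"
      by (simp add: N_def power2_eq_square sum_distrib_right mult.assoc)
    then show ?thesis by (simp add: frame_Im mixed1)
  qed
  then have mixed2: "T (\<lambda>i j. y i * x j m) = 0" for m using Npos by simp
  \<comment> \<open>Without the mixed traces the trace of the second derivative has a real part \<open>\<alpha>\<close> and an imaginary part \<open>\<beta> n\<close>; the latter is tangent, so only the component of \<open>\<alpha>\<close> along \<open>n\<close> survives.\<close>
  let ?c = "- (\<Sum>k\<in>UNIV. l k) / N"
  define \<nu> :: "complex^'m" where "\<nu> = (\<chi> k. E k u * of_real (?c * n k u))"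
  define \<alpha> where "\<alpha> k = T (\<lambda>i j. pderiv_vec i (pderiv_vec j (X k)) u) - l k * n k u * T (\<lambda>i j. y i * y j)" for k
  define \<beta> where "\<beta> = T (\<lambda>i j. pderiv_vec i (pderiv_vec j h) u)"
  let ?W = "\<Sum>i\<in>UNIV. \<Sum>j\<in>UNIV. ?gi $ i $ j *\<^sub>R pderiv_vec i (pderiv_vec j f) u"
  have W: "?W $ k = E k u * Complex (\<alpha> k) (n k u * \<beta>)" for k
  proof -
    have "?W $ k = E k u * (\<Sum>i\<in>UNIV. \<Sum>j\<in>UNIV. ?gi $ i $ j *\<^sub>R 
      Complex (pderiv_vec i (pderiv_vec j (X k)) u - l k * n k u * (y i * y j))
       (n k u * pderiv_vec i (pderiv_vec j h) u + l k * (y i * x j k + x i k * y j)))"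
      by (simp add: pderiv_pderiv_f[OF u] sum_distrib_left x_def y_def)
    also have "\<dots> = E k u * Complex (\<alpha> k) (n k u * \<beta>)"
      unfolding T_complex T_add T_diff T_mult mixed1 mixed2 \<alpha>_def \<beta>_def by simp
    finally show ?thesis .
  qed
  have \<alpha>_n: "(\<Sum>k\<in>UNIV. \<alpha> k * n k u) = - (\<Sum>k\<in>UNIV. l k)"
  proof -
    have "(\<Sum>k\<in>UNIV. \<alpha> k * n k u) = T (\<lambda>i j. \<Sum>k\<in>UNIV. n k u * pderiv_vec i (pderiv_vec j (X k)) u)
       - (\<Sum>k\<in>UNIV. l k * ((n k u)\<^sup>2 * T (\<lambda>i j. y i * y j)))"
      by (simp add: \<alpha>_def T_sum T_mult algebra_simps sum_subtractf power2_eq_square)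
    also have "(\<lambda>i j. \<Sum>k\<in>UNIV. n k u * pderiv_vec i (pderiv_vec j (X k)) u) = (\<lambda>i j. \<Sum>k\<in>UNIV. (- l k) * (x i k * x j k))"
      using level_pderiv_pderiv[OF u] by (simp add: sum.distrib sum_negf x_def fun_eq_iff eq_neg_iff_add_eq_0)
    also have "T \<dots> = (\<Sum>k\<in>UNIV. (- l k) * T (\<lambda>i j. x i k * x j k))"
      by (simp only: T_sum T_mult)
    also have "\<dots> - (\<Sum>k\<in>UNIV. l k * ((n k u)\<^sup>2 * T (\<lambda>i j. y i * y j)))
       = - (\<Sum>k\<in>UNIV. l k * (T (\<lambda>i j. x i k * x j k) + (n k u)\<^sup>2 * T (\<lambda>i j. y i * y j)))"
      by (simp add: sum_negf sum.distrib distrib_left)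
    finally show ?thesis by (simp add: frame_Re)
  qed
  have "mean_curvature_vector f u = \<nu>"
  proof (rule mean_curvature_vector_eqI[OF linear_f[OF u] imm[OF u]])
    show "?W - \<nu> \<in> range (frechet_derivative f (at u))"
    proof (rule lagrangian_tangentI[OF linear_f[OF u] imm[OF u] lag])
      fix j
      have "(?W - \<nu>) $ k = E k u * Complex (\<alpha> k - ?c * n k u) (n k u * \<beta>)" for k
        unfolding vector_minus_component W by (simp add: \<nu>_def Complex_eq algebra_simps)
      then have "kaehler_form (?W - \<nu>) (pderiv_vec j f u) =
         - (\<Sum>k\<in>UNIV. \<beta> * (n k u * x j k) - y j * (\<alpha> k * n k u) + y j * ?c * (n k u)\<^sup>2)"
        unfolding kaehler_form_eq_sum pderiv_f[OF u]
        by (simp only: E_herm) (simp add: x_def y_def algebra_simps power2_eq_square)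
      also have "\<dots> = - (\<beta> * (\<Sum>k\<in>UNIV. n k u * x j k) - y j * (\<Sum>k\<in>UNIV. \<alpha> k * n k u) + y j * ?c * N)"
        by (simp only: sum.distrib sum_subtractf sum_distrib_left N_def)
      also have "\<dots> = 0"
        using Npos by (simp add: n0 \<alpha>_n)
      finally show "kaehler_form (?W - \<nu>) (pderiv_vec j f u) = 0" .
    qed
    have "\<nu> \<bullet> pderiv_vec j f u = 0" for j
    proof -
      have "\<nu> \<bullet> pderiv_vec j f u = (\<Sum>k\<in>UNIV. ?c * (n k u * x j k))"
        unfolding inner_eq_sum pderiv_f[OF u] \<nu>_def
        by (simp only: vec_lambda_beta E_herm) (simp add: x_def mult.assoc)
      then show ?thesis by (simp only: sum_distrib_left[symmetric] n0)
    qed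
    then show "\<nu> \<bullet> frechet_derivative f (at u) v = 0" for v
      using orthogonal_range_iff[OF linear_f[OF u]] by blast
  qed
  then show ?thesis by (simp add: \<nu>_def N_def)
qed

end

section \<open>The time change of the complexified flow\<close>

text \<open>The gain of the moment map between the real point \<open>z\<close> and its image \<open>exp (s \<Lambda>) z + s e\<close> under the
complexified action with weights \<open>l\<close> (see \<open>moment_map_cflow\<close>); the summand \<open>s\<close> comes from the translated
coordinate, which has weight zero. Its derivative \<open>slope\<close> is the squared length of the gradient
of the moment map at that image.\<close>

definition rise :: "('m \<Rightarrow> real) \<Rightarrow> complex^'m \<Rightarrow> real \<Rightarrow> real" where
  "rise l z s = s + (1/2) * (\<Sum>k\<in>UNIV. l k * (Re (z $ k))\<^sup>2 * (exp (2 * l k * s) - 1))"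

definition slope :: "('m \<Rightarrow> real) \<Rightarrow> complex^'m \<Rightarrow> real \<Rightarrow> real" where
  "slope l z s = 1 + (\<Sum>k\<in>UNIV. (l k * Re (z $ k) * exp (l k * s))\<^sup>2)"

text \<open>The inverse of \<open>rise\<close>: the parameter at which the moment map has grown by \<open>\<tau>\<close>. In the translated coordinate
it is the displacement.\<close>

definition height :: "('m \<Rightarrow> real) \<Rightarrow> real \<Rightarrow> complex^'m \<Rightarrow> real" where
  "height l \<tau> z = (THE s. rise l z s = \<tau>)"

lemma slope_ge_1: "slope l z s \<ge> 1"
  by (simp add: slope_def sum_nonneg)

lemma has_derivative_rise:
  "((\<lambda>(s, z). rise l z s) has_derivative
     (\<lambda>(ds, dz). slope l z s * ds + (\<Sum>k\<in>UNIV. l k * Re (z $ k) * Re (dz $ k) * (exp (2 * l k * s) - 1)))) (at (s, z))"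
proof -
  have Rek: "bounded_linear (\<lambda>y::real \<times> (complex^'m). Re (snd y $ k))" for k
    by (intro bounded_linear_compose[OF bounded_linear_Re] bounded_linear_compose[OF bounded_linear_vec_nth] bounded_linear_snd)
  note der [derivative_intros] = bounded_linear_imp_has_derivative[OF Rek]
  have "((\<lambda>y. rise l (snd y) (fst y)) has_derivative
    (\<lambda>w. fst w + (1/2) * (\<Sum>k\<in>UNIV. (l k * (Re (z $ k))\<^sup>2) * (2 * l k * fst w * exp (2 * l k * s))
       + l k * (2 * Re (snd w $ k) * Re (z $ k)) * (exp (2 * l k * s) - 1)))) (at (s, z))"
    unfolding rise_def
    by (auto intro!: derivative_eq_intros der simp: algebra_simps)
  moreover have "fst w + (1/2) * (\<Sum>k\<in>UNIV. (l k * (Re (z $ k))\<^sup>2) * (2 * l k * fst w * exp (2 * l k * s))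
       + l k * (2 * Re (snd w $ k) * Re (z $ k)) * (exp (2 * l k * s) - 1))
     = slope l z s * fst w + (\<Sum>k\<in>UNIV. l k * Re (z $ k) * Re (snd w $ k) * (exp (2 * l k * s) - 1))" for w
    by (simp add: slope_def exp_double mult.assoc sum_distrib_left sum_distrib_right sum.distrib distrib_left distrib_right)
      (simp add: power2_eq_square mult_ac)
  ultimately show ?thesis
    by (simp add: case_prod_unfold)
qed

lemma rise_has_real_derivative: "(rise l z has_real_derivative slope l z s) (at s)"
proof -
  have "((\<lambda>s. (s, z)) has_derivative (\<lambda>ds. (ds, 0))) (at s)"
    by (auto intro!: derivative_eq_intros)
  from has_derivative_compose[OF this has_derivative_rise[of l z s]] show ?thesis
    by (simp add: has_field_derivative_def)
qed

lemma rise_0: "rise l z 0 = 0"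
  by (simp add: rise_def)

text \<open>As the slope is at least one, \<open>rise\<close> expands distances. This gives at the same time that it is onto, that it is
injective, and that its inverse depends continuously on \<open>z\<close>.\<close>

lemma rise_expanding:
  assumes "s \<le> s'"
  shows "s' - s \<le> rise l z s' - rise l z s"
proof -
  have "\<exists>y. ((\<lambda>s. rise l z s - s) has_real_derivative y) (at x) \<and> 0 \<le> y" for x
    using slope_ge_1[of l z x]
    by (intro exI[of _ "slope l z x - 1"]) (auto intro!: derivative_eq_intros rise_has_real_derivative)
  then have "rise l z s - s \<le> rise l z s' - s'"
    using assms by (intro DERIV_nonneg_imp_nondecreasing[of s s' "\<lambda>s. rise l z s - s"]) auto
  then show ?thesis by simp
qed

lemma rise_expanding_abs: "\<bar>s' - s\<bar> \<le> \<bar>rise l z s' - rise l z s\<bar>"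
  using rise_expanding[of s s' l z] rise_expanding[of s' s l z] by (cases "s \<le> s'") auto

lemma rise_height: "rise l z (height l \<tau> z) = \<tau>"
proof -
  have "\<exists>s\<ge>-\<bar>\<tau>\<bar>. s \<le> \<bar>\<tau>\<bar> \<and> rise l z s = \<tau>"
    using rise_expanding[of "-\<bar>\<tau>\<bar>" 0 l z] rise_expanding[of 0 "\<bar>\<tau>\<bar>" l z]
    by (intro IVT) (auto simp: rise_0 intro: DERIV_isCont[OF rise_has_real_derivative])
  then obtain s where s: "rise l z s = \<tau>" by blast
  show ?thesis
    unfolding height_def
  proof (rule theI[of _ s])
    show "x = s" if "rise l z x = \<tau>" for x
      using rise_expanding_abs[of x s l z] that s by simp
  qed (fact s)
qed

lemma height_eqI: "rise l z s = \<tau> \<Longrightarrow> height l \<tau> z = s"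
  using rise_expanding_abs[of "height l \<tau> z" s l z] by (simp add: rise_height)

lemma continuous_height: "continuous (at (\<tau>, z)) (\<lambda>(\<tau>, z). height l \<tau> z)"
proof -
  let ?s = "height l \<tau> z"
  have "((\<lambda>y. Re (snd y $ k)) \<longlongrightarrow> Re (z $ k)) (at (\<tau>, z))" for k
    using tendsto_snd[OF tendsto_ident_at, of "(\<tau>, z)" UNIV] by (intro tendsto_Re tendsto_vec_nth) simp
  then have c: "((\<lambda>y. rise l (snd y) ?s) \<longlongrightarrow> rise l z ?s) (at (\<tau>, z))"
    unfolding rise_def by (intro tendsto_add tendsto_const tendsto_mult tendsto_sum tendsto_power)
  have "((\<lambda>y. \<bar>fst y - rise l (snd y) ?s\<bar>) \<longlongrightarrow> \<bar>\<tau> - rise l z ?s\<bar>) (at (\<tau>, z))"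
    using tendsto_rabs[OF tendsto_diff[OF tendsto_fst[OF tendsto_ident_at] c]] by simp
  then have lim: "((\<lambda>y. \<bar>fst y - rise l (snd y) ?s\<bar>) \<longlongrightarrow> 0) (at (\<tau>, z))"
    by (simp add: rise_height)
  have bound: "norm (height l (fst y) (snd y) - ?s) \<le> \<bar>fst y - rise l (snd y) ?s\<bar>" for y
    using rise_expanding_abs[of "height l (fst y) (snd y)" ?s l "snd y"] by (simp add: rise_height)
  have "((\<lambda>y. height l (fst y) (snd y) - ?s) \<longlongrightarrow> 0) (at (\<tau>, z))"
    by (rule Lim_null_comparison[OF always_eventually[OF allI[OF bound]] lim])
  then have "((\<lambda>y. height l (fst y) (snd y)) \<longlongrightarrow> ?s) (at (\<tau>, z))"
    by (rule LIM_zero_cancel)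
  then show ?thesis
    unfolding isCont_def case_prod_unfold by simp
qed

text \<open>The implicit function theorem, obtained from the derivative of the inverse of the map
\<open>(s, z) \<mapsto> (rise l z s, z)\<close>, whose derivative is triangular.\<close>

lemma has_derivative_height:
  "((\<lambda>(\<tau>, z). height l \<tau> z) has_derivative
     (\<lambda>(d\<tau>, dz). inverse (slope l z (height l \<tau> z)) *
        (d\<tau> - (\<Sum>k\<in>UNIV. l k * Re (z $ k) * Re (dz $ k) * (exp (2 * l k * height l \<tau> z) - 1))))) (at (\<tau>, z))"
proof -
  define s where "s = height l \<tau> z"
  define \<rho> where "\<rho> = (\<lambda>dz :: complex^'a. \<Sum>k\<in>UNIV. l k * Re (z $ k) * Re (dz $ k) * (exp (2 * l k * s) - 1))"
  let ?\<Psi> = "\<lambda>y. (rise l (snd y) (fst y), snd y)"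
  let ?g = "\<lambda>y. (height l (fst y) (snd y), snd y)"
  let ?g' = "\<lambda>w. (inverse (slope l z s) * (fst w - \<rho> (snd w)), snd w)"
  have sl: "slope l z s \<noteq> 0" using slope_ge_1[of l z s] by simp
  have \<rho>: "bounded_linear \<rho>"
    unfolding \<rho>_def linear_conv_bounded_linear[symmetric]
    by (intro linearI) (auto simp: algebra_simps sum.distrib sum_subtractf sum_distrib_left)
  have "(?g has_derivative ?g') (at (\<tau>, z))"
  proof (rule has_derivative_inverse_basic[where f = ?\<Psi> and T = UNIV])
    show "(?\<Psi> has_derivative (\<lambda>w. (slope l z s * fst w + \<rho> (snd w), snd w))) (at (?g (\<tau>, z)))"
      using has_derivative_rise[of l z s]
      by (auto intro!: derivative_eq_intros simp: s_def \<rho>_def case_prod_unfold)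
    show "bounded_linear ?g'"
      by (intro bounded_linear_Pair bounded_linear_mult_const bounded_linear_const_mult bounded_linear_sub
         bounded_linear_fst bounded_linear_snd bounded_linear_compose[OF \<rho>])
    show "?g' \<circ> (\<lambda>w. (slope l z s * fst w + \<rho> (snd w), snd w)) = id"
      using sl by (auto simp: fun_eq_iff field_simps)
    show "continuous (at (\<tau>, z)) ?g"
      using continuous_height[of \<tau> z l] by (auto intro!: continuous_intros simp: case_prod_unfold)
  qed (auto simp: rise_height)
  from has_derivative_fst[OF this] show ?thesis
    by (simp add: case_prod_unfold s_def \<rho>_def)
qed

text \<open>The derivative of \<open>height\<close> is a smooth expression in \<open>z\<close> and \<open>height\<close> itself, so regularity improves
by one order at each step of the induction.\<close>

lemma Ck_on_height: "Ck_on k (\<lambda>(\<tau>, z). height l \<tau> z) UNIV"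
proof (induction k)
  case 0
  have "isCont (\<lambda>(\<tau>, z). height l \<tau> z) y" for y
    using has_derivative_continuous[OF has_derivative_height[where l = l and \<tau> = "fst y" and z = "snd y"]]
    by simp
  then show ?case
    by (simp add: continuous_at_imp_continuous_on)
next
  case (Suc n)
  show ?case
  proof (rule Ck_on_SucI)
    \<comment> \<open>Differences are written as sums, the form in which the closure rules apply.\<close>
    show "((\<lambda>(\<tau>, z). height l \<tau> z) has_derivative
     (\<lambda>w. inverse (slope l (snd y) (height l (fst y) (snd y))) *
        (fst w + (\<Sum>k\<in>UNIV. - (l k * Re (snd y $ k) * Re (snd w $ k) * (exp (2 * l k * height l (fst y) (snd y)) + - 1)))))) (at y)" for y
      using has_derivative_height[where l = l and \<tau> = "fst y" and z = "snd y"] by (simp add: case_prod_unfold sum_negf)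
    have h: "Ck_on n (\<lambda>y. height l (fst y) (snd y)) UNIV"
      using Suc by (simp add: case_prod_unfold)
    have p: "Ck_on n (\<lambda>y :: real \<times> (complex^'a). Re (snd y $ k)) UNIV" for k
      by (intro Ck_on_bounded_linear bounded_linear_compose[OF bounded_linear_Re] 
          bounded_linear_compose[OF bounded_linear_vec_nth] bounded_linear_snd open_UNIV)
    have i: "Ck_on n (\<lambda>y. inverse (slope l (snd y) (height l (fst y) (snd y)))) UNIV"
    proof (rule Ck_on_compose[where T = "- {0}" and g = inverse, OF _ _ _ _ Ck_on_inverse])
      show "slope l (snd x) (height l (fst x) (snd x)) \<in> - {0}" for x
        using slope_ge_1[of l "snd x" "height l (fst x) (snd x)"] by auto
      show "Ck_on n (\<lambda>y. slope l (snd y) (height l (fst y) (snd y))) UNIV"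
        unfolding slope_def
        by (intro Ck_on_add Ck_on_sum Ck_on_power Ck_on_mult Ck_on_exp_compose Ck_on_const open_UNIV h p)
    qed auto
    show "Ck_on n (\<lambda>y. inverse (slope l (snd y) (height l (fst y) (snd y))) *
        (fst w + (\<Sum>k\<in>UNIV. - (l k * Re (snd y $ k) * Re (snd w $ k) * (exp (2 * l k * height l (fst y) (snd y)) + - 1))))) UNIV" for w
      by (intro Ck_on_mult Ck_on_add Ck_on_sum Ck_on_linear_compose[OF bounded_linear_minus[OF bounded_linear_ident]]
          Ck_on_exp_compose Ck_on_const open_UNIV h p i)
  qed auto
qed

section \<open>Integral curves of \<open>\<chi>\<close>\<close>

text \<open>With \<open>weight\<close> and \<open>shift\<close> the rotated coordinates and the translated one obey the same formulas: the action
multiplies coordinate \<open>k\<close> by \<open>exp (\<i> * weight lam k * t)\<close> and adds \<open>\<i> * shift k * t\<close>.\<close>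

definition weight :: "('d \<Rightarrow> real) \<Rightarrow> 'd option \<Rightarrow> real" where
  "weight lam k = (case k of Some i \<Rightarrow> lam i | None \<Rightarrow> 0)"

definition shift :: "'d option \<Rightarrow> real" where
  "shift k = (case k of Some i \<Rightarrow> 0 | None \<Rightarrow> 1)"

lemma weight_shift: "weight lam k * shift k = 0"
  by (simp add: weight_def shift_def split: option.split)

lemma sum_UNIV_option:
  fixes g :: "'d::finite option \<Rightarrow> 'a::comm_monoid_add"
  shows "(\<Sum>k\<in>UNIV. g k) = g None + (\<Sum>i\<in>UNIV. g (Some i))"
  by (simp add: UNIV_option_conv sum.reindex)

lemma sum_weight: "(\<Sum>k\<in>UNIV. weight lam k) = (\<Sum>i\<in>UNIV. lam i)" for lam :: "'d::finite \<Rightarrow> real"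
  unfolding sum_UNIV_option by (simp add: weight_def)

lemma sum_shift: "(\<Sum>k\<in>UNIV. shift k * g k) = g None" for g :: "'d::finite option \<Rightarrow> real"
  unfolding sum_UNIV_option by (simp add: shift_def)

lemma act_nth:
  "act lam z t $ k = z $ k * exp (\<i> * of_real (weight lam k * t)) + \<i> * of_real (shift k * t)"
  by (simp add: act_def weight_def shift_def split: option.split)

lemma moment_map_real:
  assumes "z \<in> real_points"
  shows "blinfun_apply (moment_map lam z) 1 =
     (1/2) * (\<Sum>k\<in>UNIV. weight lam k * (Re (z $ k))\<^sup>2) + (\<Sum>k\<in>UNIV. shift k * Re (z $ k))"
proof -
  have "(cmod (z $ k))\<^sup>2 = (Re (z $ k))\<^sup>2" for k
    using assms by (simp add: real_points_def cmod_power2 complex_is_Real_iff)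
  then show ?thesis
    by (simp add: moment_map_def sum_UNIV_option weight_def shift_def scaleR_blinfun.rep_eq)
qed

lemma moment_map_eq_iff: "moment_map lam z = c \<longleftrightarrow> blinfun_apply (moment_map lam z) 1 = blinfun_apply c 1"
proof
  assume *: "blinfun_apply (moment_map lam z) 1 = blinfun_apply c 1"
  show "moment_map lam z = c"
  proof (rule blinfun_eqI)
    fix x :: real
    have "blinfun_apply b x = x * blinfun_apply b 1" for b :: "real \<Rightarrow>\<^sub>L real"
      using blinfun.scaleR_right[of b x 1] by simp
    then show "blinfun_apply (moment_map lam z) x = blinfun_apply c x"
      using * by simp
  qed
qed simp

lemma fundamental_vf_nth:
  "fundamental_vf lam \<xi> z $ k = \<i> * of_real \<xi> * (of_real (weight lam k) * z $ k + of_real (shift k))"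
proof -
  have "((\<lambda>t. act lam z (t *\<^sub>R \<xi>)) has_derivative
     (\<lambda>t. \<chi> k. t *\<^sub>R (\<i> * of_real \<xi> * (of_real (weight lam k) * z $ k + of_real (shift k))))) (at 0)"
  proof (rule has_derivative_vec)
    fix k
    have e: "((\<lambda>t. exp (\<i> * of_real (weight lam k * (t *\<^sub>R \<xi>)))) has_derivative
       (\<lambda>t. exp (\<i> * of_real (weight lam k * (0 *\<^sub>R \<xi>))) * (\<i> * of_real (weight lam k * (t *\<^sub>R \<xi>))))) (at 0)"
      by (rule has_derivative_compose[where g = exp, OF _ DERIV_exp[unfolded has_field_derivative_def]])
        (auto intro!: derivative_eq_intros has_derivative_of_real)
    have "((\<lambda>t. z $ k * exp (\<i> * of_real (weight lam k * (t *\<^sub>R \<xi>))) + \<i> * of_real (shift k * (t *\<^sub>R \<xi>)))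
       has_derivative (\<lambda>t. t *\<^sub>R (\<i> * of_real \<xi> * (of_real (weight lam k) * z $ k + of_real (shift k))))) (at 0)"
      by (rule derivative_eq_intros has_derivative_of_real e refl ext | simp add: scaleR_conv_of_real algebra_simps)+
    then show "((\<lambda>t. act lam z (t *\<^sub>R \<xi>) $ k) has_derivative
      (\<lambda>t. (\<chi> k. t *\<^sub>R (\<i> * of_real \<xi> * (of_real (weight lam k) * z $ k + of_real (shift k)))) $ k)) (at 0)"
      by (simp add: act_nth)
  qed
  moreover have "(\<lambda>t. \<chi> k. t *\<^sub>R (\<i> * of_real \<xi> * (of_real (weight lam k) * z $ k + of_real (shift k))))
     = (\<lambda>t. t *\<^sub>R (\<chi> k. \<i> * of_real \<xi> * (of_real (weight lam k) * z $ k + of_real (shift k))))"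
    by (simp add: fun_eq_iff vec_eq_iff)
  ultimately have "fundamental_vf lam \<xi> z = (\<chi> k. \<i> * of_real \<xi> * (of_real (weight lam k) * z $ k + of_real (shift k)))"
    unfolding fundamental_vf_def by (intro vector_derivative_at) (simp add: has_vector_derivative_def)
  then show ?thesis by simp
qed

text \<open>The vector field generated by \<open>\<xi>\<close> is \<open>\<i> \<xi> n\<close> with \<open>n\<close> real and nonzero, so the equation
defining \<open>xi_tilde\<close> reads \<open>\<xi> |n|\<^sup>2 = a\<close>.\<close>

lemma chi_vf_nth:
  assumes "x \<in> real_points"
  shows "chi_vf lam x $ k =
    of_real (- (\<Sum>i\<in>UNIV. lam i) / (\<Sum>k\<in>UNIV. (weight lam k * Re (x $ k) + shift k)\<^sup>2) * (weight lam k * Re (x $ k) + shift k))"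
proof -
  let ?n = "\<lambda>k. weight lam k * Re (x $ k) + shift k"
  let ?N = "\<Sum>k\<in>UNIV. (?n k)\<^sup>2"
  have x: "x $ k = of_real (Re (x $ k))" for k
    using assms by (simp add: real_points_def)
  have n: "of_real (weight lam k) * x $ k + of_real (shift k) = complex_of_real (?n k)" for k
    by (subst x) simp
  have f: "fundamental_vf lam \<xi> x $ k = \<i> * of_real (\<xi> * ?n k)" for \<xi> k
    by (simp only: fundamental_vf_nth n) simp
  have inner: "fundamental_vf lam \<xi> x \<bullet> fundamental_vf lam \<eta> x = \<xi> * \<eta> * ?N" for \<xi> \<eta>
    unfolding inner_vec_def f by (simp add: inner_complex_def sum_distrib_left power2_eq_square mult_ac)
  have N: "?N > 0"
    by (rule sum_pos2[of _ None]) (auto simp: weight_def shift_def)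
  have "xi_tilde lam x = (\<Sum>i\<in>UNIV. lam i) / ?N"
    unfolding xi_tilde_def inner
  proof (rule the_equality)
    show "\<forall>\<eta>. (\<Sum>i\<in>UNIV. lam i) / ?N * \<eta> * ?N = blinfun_apply (a_H lam) \<eta>"
      using N by (simp add: a_H_def scaleR_blinfun.rep_eq)
    show "\<xi> = (\<Sum>i\<in>UNIV. lam i) / ?N" if "\<forall>\<eta>. \<xi> * \<eta> * ?N = blinfun_apply (a_H lam) \<eta>" for \<xi>
      using that[rule_format, of 1] N by (simp add: a_H_def scaleR_blinfun.rep_eq field_simps)
  qed
  then show ?thesis
    by (simp add: chi_vf_def cplx_structure_def f)
qed

text \<open>The action on real points of the group element with parameter \<open>- \<i> s\<close> in the complexification of
\<open>H\<close>. It preserves the real points, whereas \<open>H\<close> itself does not.\<close>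

definition cflow :: "('d \<Rightarrow> real) \<Rightarrow> real \<Rightarrow> complex^('d::finite option) \<Rightarrow> complex^('d option)" where
  "cflow lam s p = (\<chi> k. of_real (Re (p $ k) * exp (weight lam k * s) + shift k * s))"

lemma cflow_real: "cflow lam s p \<in> real_points"
  by (simp add: real_points_def cflow_def)

lemma shift_exp: "shift k * exp (weight lam k * s) = shift k"
  by (simp add: weight_def shift_def split: option.split)

lemma slope_cflow:
  "(\<Sum>k\<in>UNIV. (weight lam k * Re (cflow lam s p $ k) + shift k)\<^sup>2) = slope (weight lam) p s"
  by (simp add: sum_UNIV_option cflow_def slope_def) (simp add: weight_def shift_def mult.assoc)

text \<open>Every coordinate of an integral curve satisfies the linear equation \<open>r' = v (weight * r + shift)\<close> with one
common speed \<open>v\<close>, and \<open>v\<close> is the derivative \<open>s'\<close> of the displacement of the translated coordinate. Hence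
the curve is \<open>cflow lam (s t) p\<close>, and \<open>rise\<close> along it has constant derivative \<open>- a\<close>, which
determines \<open>s\<close>.\<close>

lemma is_chi_curve_iff:
  assumes p: "p \<in> real_points"
  shows "is_chi_curve lam p \<gamma> \<longleftrightarrow>
     \<gamma> = (\<lambda>t. cflow lam (height (weight lam) (- t * (\<Sum>i\<in>UNIV. lam i)) p) p)"
proof
  let ?a = "\<Sum>i\<in>UNIV. lam i"
  assume \<gamma>: "is_chi_curve lam p \<gamma>"
  define r where "r k t = Re (\<gamma> t $ k)" for k t
  define s where "s t = r None t - Re (p $ None)" for t
  define v where "v t = - ?a / (\<Sum>k\<in>UNIV. (weight lam k * r k t + shift k)\<^sup>2)" for t
  have real: "\<gamma> t \<in> real_points" for t
    using \<gamma> by (simp add: is_chi_curve_def)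
  have dr: "(r k has_real_derivative v t * (weight lam k * r k t + shift k)) (at t)" for k t
  proof -
    have "(\<gamma> has_vector_derivative chi_vf lam (\<gamma> t)) (at t)"
      using \<gamma> by (simp add: is_chi_curve_def)
    then have "((\<lambda>t. Re (\<gamma> t $ k)) has_vector_derivative Re (chi_vf lam (\<gamma> t) $ k)) (at t)"
      by (intro bounded_linear.has_vector_derivative[OF bounded_linear_Re]
          bounded_linear.has_vector_derivative[OF bounded_linear_vec_nth])
    then show ?thesis
      unfolding chi_vf_nth[OF real]
      by (simp add: has_real_derivative_iff_has_vector_derivative r_def[abs_def] v_def)
  qed
  have ds: "(s has_real_derivative v t) (at t)" for t
    using dr[of None t] unfolding s_def by (auto intro!: derivative_eq_intros simp: weight_def shift_def)
  have s0: "s 0 = 0"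
    using \<gamma> by (simp add: s_def r_def is_chi_curve_def)
  have r_eq: "r k t = Re (p $ k) * exp (weight lam k * s t) + shift k * s t" for k t
  proof (cases k)
    case None
    then show ?thesis by (simp add: s_def weight_def shift_def)
  next
    case (Some i)
    \<comment> \<open>Variation of constants: the quotient by the homogeneous solution is constant.\<close>
    have "((\<lambda>t. r k t * exp (- weight lam k * s t)) has_real_derivative 0) (at t)" for t
      using Some by (auto intro!: derivative_eq_intros dr ds simp: shift_def algebra_simps)
    then have "r k t * exp (- weight lam k * s t) = r k 0 * exp (- weight lam k * s 0)"
      by (intro DERIV_isconst_all) auto
    then have "r k t * exp (- weight lam k * s t) * exp (weight lam k * s t) = Re (p $ k) * exp (weight lam k * s t)"
      using \<gamma> by (simp add: s0 r_def is_chi_curve_def)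
    then show ?thesis
      using Some by (simp add: mult.assoc shift_def flip: exp_add)
  qed
  have \<gamma>_eq: "\<gamma> t = cflow lam (s t) p" for t
    using real[of t] by (auto simp: vec_eq_iff cflow_def real_points_def r_eq[symmetric] r_def simp del: of_real_add of_real_mult)
  have v_eq: "v t = - ?a / slope (weight lam) p (s t)" for t
    by (simp add: v_def r_def \<gamma>_eq slope_cflow)
  have "((\<lambda>t. rise (weight lam) p (s t) + t * ?a) has_real_derivative 0) (at t)" for t
    using slope_ge_1[of "weight lam" p "s t"]
    by (auto intro!: derivative_eq_intros DERIV_chain2[OF rise_has_real_derivative ds] simp: v_eq)
  then have "rise (weight lam) p (s t) + t * ?a = rise (weight lam) p (s 0) + 0 * ?a" for t
    by (intro DERIV_isconst_all[of "\<lambda>t. rise (weight lam) p (s t) + t * ?a"]) auto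
  then have "rise (weight lam) p (s t) = - t * ?a" for t
    by (simp add: s0 rise_0 eq_neg_iff_add_eq_0)
  then have "height (weight lam) (- t * ?a) p = s t" for t
    by (rule height_eqI)
  then show "\<gamma> = (\<lambda>t. cflow lam (height (weight lam) (- t * ?a) p) p)"
    using \<gamma>_eq by (simp add: fun_eq_iff)
next
  let ?a = "\<Sum>i\<in>UNIV. lam i"
  define s where "s t = height (weight lam) (- t * ?a) p" for t
  assume "\<gamma> = (\<lambda>t. cflow lam (height (weight lam) (- t * (\<Sum>i\<in>UNIV. lam i)) p) p)"
  then have \<gamma>: "\<gamma> = (\<lambda>t. cflow lam (s t) p)"
    by (simp add: s_def)
  have ds: "(s has_real_derivative - ?a / slope (weight lam) p (s t)) (at t)" for t
  proof -
    have "((\<lambda>t. (- t * ?a, p)) has_derivative (\<lambda>dt. (- dt * ?a, 0))) (at t)"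
      by (auto intro!: derivative_eq_intros)
    from has_derivative_compose[OF this has_derivative_height[of "weight lam" p "- t * ?a"]]
    have "(s has_derivative (\<lambda>dt. inverse (slope (weight lam) p (s t)) * (- dt * ?a))) (at t)"
      by (simp add: s_def[abs_def])
    then show ?thesis
      unfolding has_field_derivative_def
      by (rule has_derivative_eq_rhs) (simp add: fun_eq_iff divide_inverse)
  qed
  have "s 0 = 0"
    unfolding s_def by (intro height_eqI) (simp add: rise_0)
  then have "\<gamma> 0 = p"
    using p by (simp add: \<gamma> cflow_def vec_eq_iff real_points_def)
  moreover have "(\<gamma> has_vector_derivative chi_vf lam (\<gamma> t)) (at t)" for t
    unfolding has_vector_derivative_def
  proof (rule has_derivative_vec)
    fix k
    let ?v = "- ?a / slope (weight lam) p (s t)"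
    have "((\<lambda>t. Re (p $ k) * exp (weight lam k * s t) + shift k * s t) has_real_derivative
       Re (p $ k) * (exp (weight lam k * s t) * (weight lam k * ?v)) + shift k * ?v) (at t)"
      by (auto intro!: derivative_eq_intros ds simp: mult_ac)
    then have "((\<lambda>t. of_real (Re (p $ k) * exp (weight lam k * s t) + shift k * s t) :: complex) has_vector_derivative
       of_real (Re (p $ k) * (exp (weight lam k * s t) * (weight lam k * ?v)) + shift k * ?v)) (at t)"
      by (intro bounded_linear.has_vector_derivative[OF bounded_linear_of_real])
        (simp add: has_real_derivative_iff_has_vector_derivative)
    moreover have "Re (p $ k) * (exp (weight lam k * s t) * (weight lam k * ?v)) + shift k * ?v
      = ?v * (weight lam k * Re (\<gamma> t $ k) + shift k)"
    proof -
      have "p * (e * (w * v)) + d * v = v * (w * (p * e + d * x) + d)" if "w * d = 0" for p e w d v x :: real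
        using that by algebra
      from this[OF weight_shift] show ?thesis
        by (simp only: \<gamma> cflow_def vec_lambda_beta Re_complex_of_real)
    qed
    moreover have "chi_vf lam (\<gamma> t) $ k = of_real (?v * (weight lam k * Re (\<gamma> t $ k) + shift k))"
      unfolding \<gamma> by (simp only: chi_vf_nth[OF cflow_real] slope_cflow)
    ultimately have "((\<lambda>t. of_real (Re (p $ k) * exp (weight lam k * s t) + shift k * s t)) has_vector_derivative
       chi_vf lam (\<gamma> t) $ k) (at t)"
      by (simp only:)
    then show "((\<lambda>t. \<gamma> t $ k) has_derivative (\<lambda>x. (x *\<^sub>R chi_vf lam (\<gamma> t)) $ k)) (at t)"
      by (simp only: has_vector_derivative_def \<gamma> cflow_def vec_lambda_beta vector_scaleR_component)
  qed
  ultimately show "is_chi_curve lam p \<gamma>"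
    by (simp add: is_chi_curve_def \<gamma> cflow_real)
qed

lemma chi_curve_eq:
  assumes "p \<in> real_points"
  shows "chi_curve lam p t = cflow lam (height (weight lam) (- t * (\<Sum>i\<in>UNIV. lam i)) p) p"
  unfolding chi_curve_def is_chi_curve_iff[OF assms] by simp

lemma moment_map_cflow:
  assumes "p \<in> real_points"
  shows "blinfun_apply (moment_map lam (cflow lam s p)) 1
    = blinfun_apply (moment_map lam p) 1 + rise (weight lam) p s"
proof -
  have "weight lam k * (Re (p $ k) * exp (weight lam k * s) + shift k * s)\<^sup>2
     = weight lam k * (Re (p $ k))\<^sup>2 + weight lam k * (Re (p $ k))\<^sup>2 * (exp (2 * weight lam k * s) - 1)" for k
  proof (cases k)
    case (Some i)
    have "exp (2 * weight lam k * s) = (exp (weight lam k * s))\<^sup>2"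
      using exp_double[of "weight lam k * s"] by (simp add: mult.assoc)
    then show ?thesis
      using Some by (simp add: shift_def power_mult_distrib algebra_simps)
  qed (simp add: weight_def)
  then have "(\<Sum>k\<in>UNIV. weight lam k * (Re (cflow lam s p $ k))\<^sup>2) = (\<Sum>k\<in>UNIV. weight lam k * (Re (p $ k))\<^sup>2)
      + (\<Sum>k\<in>UNIV. weight lam k * (Re (p $ k))\<^sup>2 * (exp (2 * weight lam k * s) - 1))"
    by (simp add: cflow_def sum.distrib)
  moreover have "(\<Sum>k\<in>UNIV. shift k * Re (cflow lam s p $ k)) = (\<Sum>k\<in>UNIV. shift k * Re (p $ k)) + s"
    by (simp add: sum_UNIV_option cflow_def shift_def weight_def)
  ultimately show ?thesis
    by (simp add: moment_map_real[OF cflow_real] moment_map_real[OF assms] rise_def)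
qed

section \<open>The flow in an arbitrary chart\<close>

definition level_set :: "('d \<Rightarrow> real) \<Rightarrow> (real \<Rightarrow>\<^sub>L real) \<Rightarrow> (complex^('d::finite option)) set" where
  "level_set lam c = moment_map lam -` {c} \<inter> real_points"

text \<open>The moment map is affine with coefficient one in the translated coordinate, so the level set is a graph
over the rotated coordinates. The parameter in the position \<open>None\<close>, which the graph leaves free, is used for the
group variable. The chart has a linear left inverse, which yields both injectivity of its derivative and the
homeomorphism property.\<close>

lemma submanifold_level_set:
  "submanifold TYPE('d option) (level_set lam c \<times> (UNIV :: real set))"
  for lam :: "'d::finite \<Rightarrow> real"
proof -
  define Y :: "real^('d option) \<Rightarrow> 'd option \<Rightarrow> real" where
    "Y u k = (1 - shift k) * u $ k + shift k * (blinfun_apply c 1 - (1/2) * (\<Sum>k\<in>UNIV. weight lam k * (u $ k)\<^sup>2))" for u k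
  define \<phi> :: "real^('d option) \<Rightarrow> (complex^('d option)) \<times> real" where "\<phi> u = (\<chi> k. of_real (Y u k), u $ None)" for u
  define \<psi> :: "(complex^('d option)) \<times> real \<Rightarrow> real^('d option)" where
    "\<psi> y = (\<chi> k. (1 - shift k) * Re (fst y $ k) + shift k * snd y)" for y
  have shift_cases: "shift k = 0 \<or> shift k = 1 \<and> k = None" for k :: "'d option"
    by (simp add: shift_def split: option.split)
  have left_inv: "\<psi> (\<phi> u) = u" for u
    unfolding vec_eq_iff
  proof
    fix k show "\<psi> (\<phi> u) $ k = u $ k"
      using shift_cases[of k] by (auto simp: \<psi>_def \<phi>_def Y_def)
  qed
  have right_inv: "\<phi> (\<psi> y) = y" if "y \<in> level_set lam c \<times> UNIV" for y
  proof -
    have z: "fst y \<in> real_points" and "blinfun_apply (moment_map lam (fst y)) 1 = blinfun_apply c 1"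
      using that by (auto simp: level_set_def)
    then have c: "blinfun_apply c 1 = (1/2) * (\<Sum>k\<in>UNIV. weight lam k * (Re (fst y $ k))\<^sup>2) + Re (fst y $ None)"
      by (simp add: moment_map_real sum_shift)
    have w: "weight lam k * (\<psi> y $ k)\<^sup>2 = weight lam k * (Re (fst y $ k))\<^sup>2" for k
      using weight_shift[of lam k] shift_cases[of k] by (auto simp: \<psi>_def)
    have "Y (\<psi> y) k = Re (fst y $ k)" for k
      using shift_cases[of k] by (auto simp: Y_def w c) (simp add: \<psi>_def)
    moreover have "\<psi> y $ None = snd y"
      by (simp add: \<psi>_def shift_def)
    ultimately show ?thesis
      using z by (auto simp: \<phi>_def prod_eq_iff vec_eq_iff real_points_def)
  qed
  have mem: "\<phi> u \<in> level_set lam c \<times> UNIV" for u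
  proof -
    have r: "fst (\<phi> u) \<in> real_points" by (simp add: \<phi>_def real_points_def)
    have w: "weight lam k * (Y u k)\<^sup>2 = weight lam k * (u $ k)\<^sup>2" for k
      using weight_shift[of lam k] shift_cases[of k] by (auto simp: Y_def)
    have "blinfun_apply (moment_map lam (fst (\<phi> u))) 1 = (1/2) * (\<Sum>k\<in>UNIV. weight lam k * (u $ k)\<^sup>2) + (\<Sum>k\<in>UNIV. shift k * Y u k)"
      by (simp add: moment_map_real[OF r]) (simp add: \<phi>_def w)
    also have "(\<Sum>k\<in>UNIV. shift k * Y u k) = Y u None"
      by (rule sum_shift)
    also have "Y u None = blinfun_apply c 1 - (1/2) * (\<Sum>k\<in>UNIV. weight lam k * (u $ k)\<^sup>2)"
      by (simp add: Y_def shift_def)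
    finally have "moment_map lam (fst (\<phi> u)) = c"
      unfolding moment_map_eq_iff by simp
    with r show ?thesis by (simp add: level_set_def mem_Times_iff)
  qed
  have range: "range \<phi> = level_set lam c \<times> UNIV"
    using mem right_inv by (metis (no_types, lifting) UNIV_I image_subset_iff rangeI subsetI subset_antisym)
  have coord: "Ck_on k (\<lambda>u :: real^('d option). u $ j) UNIV" for k j
    by (intro Ck_on_bounded_linear bounded_linear_vec_nth open_UNIV)
  have Y: "Ck_on k (\<lambda>u. Y u j) UNIV" for k j
    unfolding Y_def diff_conv_add_uminus
    by (intro Ck_on_add Ck_on_mult Ck_on_const Ck_on_sum Ck_on_power coord open_UNIV
        Ck_on_linear_compose[OF bounded_linear_minus[OF bounded_linear_ident]])
  have smooth: "Ck_on k \<phi> UNIV" for k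
  proof -
    have "Ck_on k (\<lambda>u. (\<chi> j. of_real (Y u j)) :: complex^('d option)) UNIV"
      by (rule Ck_on_vec) (auto intro: Ck_on_of_real Y)
    then show ?thesis
      unfolding \<phi>_def by (intro Ck_on_Pair coord open_UNIV)
  qed
  have \<psi>_lin: "bounded_linear \<psi>"
    unfolding \<psi>_def linear_conv_bounded_linear[symmetric]
    by (intro linearI) (auto simp: vec_eq_iff algebra_simps)
  have "inj (frechet_derivative \<phi> (at u))" for u
  proof -
    have "(\<phi> has_derivative frechet_derivative \<phi> (at u)) (at u)"
      by (rule Ck_on_has_derivative[OF smooth]) auto
    from bounded_linear.has_derivative[OF \<psi>_lin this]
    have "((\<lambda>u. u) has_derivative (\<lambda>v. \<psi> (frechet_derivative \<phi> (at u) v))) (at u)"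
      by (simp add: left_inv)
    from has_derivative_unique[OF this has_derivative_ident]
    show ?thesis by (metis injI)
  qed
  moreover have "homeomorphism UNIV (\<phi> ` UNIV) \<phi> \<psi>"
    using smooth[of 0] bounded_linear.continuous_on[OF \<psi>_lin continuous_on_id]
    by (intro homeomorphismI) (auto simp: left_inv)
  ultimately have "local_param (level_set lam c \<times> UNIV) UNIV \<phi>"
    unfolding local_param_def immersion_on_def smooth_on_def range using smooth by auto
  then show ?thesis
    unfolding submanifold_def range[symmetric] by blast
qed

lemma level_set_deriv:
  fixes Y :: "'m::finite \<Rightarrow> 'a::euclidean_space \<Rightarrow> real"
  assumes "open U" "v \<in> U" and dY: "\<And>k. (Y k has_derivative Y' k) (at v)"
    and const: "\<And>u. u \<in> U \<Longrightarrow> (1/2) * (\<Sum>k\<in>UNIV. l k * (Y k u)\<^sup>2) + (\<Sum>k\<in>UNIV. d k * Y k u) = c"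
  shows "(\<Sum>k\<in>UNIV. (l k * Y k v + d k) * Y' k w) = 0"
proof -
  let ?D = "\<lambda>w. (1/2) * (\<Sum>k\<in>UNIV. l k * (2 * Y' k w * Y k v)) + (\<Sum>k\<in>UNIV. d k * Y' k w)"
  have "((\<lambda>u. (1/2) * (\<Sum>k\<in>UNIV. l k * (Y k u)\<^sup>2) + (\<Sum>k\<in>UNIV. d k * Y k u)) has_derivative ?D) (at v)"
    by (auto intro!: derivative_eq_intros dY)
  then have "((\<lambda>u. c) has_derivative ?D) (at v)"
    by (rule has_derivative_transform_within_open[OF _ assms(1,2)]) (rule const)
  then have "?D = (\<lambda>w. 0)"
    by (rule has_derivative_unique) (rule has_derivative_const)
  from fun_cong[OF this, of w] show ?thesis
    by (simp add: sum_distrib_left sum.distrib algebra_simps)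
qed

text \<open>A chart enters only as an immersion of an open set into the product of the level set and the group. Here
\<open>P\<close> and \<open>h\<close> are the real coordinates of its two components, \<open>s t\<close> the parameter of the complexified flow reached at time \<open>t\<close>,
\<open>X t\<close> the real point moved by that flow, and \<open>G t\<close> the immersion of the flow in the chart.\<close>

locale level_set_chart =
  fixes lam :: "'d::finite \<Rightarrow> real" and c :: "real \<Rightarrow>\<^sub>L real"
    and U :: "(real^('d option)) set" and \<phi> :: "real^('d option) \<Rightarrow> (complex^('d option)) \<times> real"
  assumes open_U: "open U" and imm: "immersion_on U \<phi>"
    and mem: "\<And>u. u \<in> U \<Longrightarrow> \<phi> u \<in> level_set lam c \<times> UNIV"
begin

abbreviation "P \<equiv> \<lambda>k u. Re (fst (\<phi> u) $ k)"
abbreviation "h \<equiv> \<lambda>u. snd (\<phi> u)"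
definition s :: "real \<Rightarrow> real^('d option) \<Rightarrow> real" where
  "s t u = height (weight lam) (- t * (\<Sum>i\<in>UNIV. lam i)) (fst (\<phi> u))"
definition X :: "real \<Rightarrow> 'd option \<Rightarrow> real^('d option) \<Rightarrow> real" where
  "X t k u = P k u * exp (weight lam k * s t u) + shift k * s t u"
definition G :: "real \<Rightarrow> real^('d option) \<Rightarrow> complex^('d option)" where
  "G t u = act lam (chi_curve lam (fst (\<phi> u)) t) (snd (\<phi> u))"

lemma real: "u \<in> U \<Longrightarrow> fst (\<phi> u) \<in> real_points"
  and mu: "u \<in> U \<Longrightarrow> moment_map lam (fst (\<phi> u)) = c"
  using mem[of u] by (auto simp: level_set_def)

lemma curve_nth: "u \<in> U \<Longrightarrow> chi_curve lam (fst (\<phi> u)) t $ k = of_real (X t k u)"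
  by (simp add: chi_curve_eq[OF real] cflow_def X_def s_def)

lemma G_nth: "u \<in> U \<Longrightarrow> G t u $ k = of_real (X t k u) * exp (\<i> * of_real (weight lam k * h u)) + \<i> * of_real (shift k * h u)"
  by (simp add: G_def act_nth curve_nth)

lemma curve_real: "u \<in> U \<Longrightarrow> chi_curve lam (fst (\<phi> u)) t \<in> real_points"
  by (simp add: chi_curve_eq[OF real] cflow_real)

lemma Ck_\<phi>: "Ck_on k \<phi> U"
  using imm by (simp add: immersion_on_def smooth_on_def)

lemma Ck_P: "Ck_on k (P j) U"
  by (intro Ck_on_Re Ck_on_nth Ck_on_fst Ck_\<phi> open_U)

lemma Ck_h: "Ck_on k h U"
  by (intro Ck_on_snd Ck_\<phi> open_U)

lemma open_times: "open (UNIV \<times> U)" by (simp add: open_Times open_U)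

lemma Ck_lift:
  fixes f :: "real^('d option) \<Rightarrow> 'b::real_normed_vector"
  assumes "Ck_on k f U" shows "Ck_on k (\<lambda>y :: real \<times> _. f (snd y)) (UNIV \<times> U)"
  by (rule Ck_on_compose[OF open_times open_U _ Ck_on_bounded_linear[OF bounded_linear_snd open_times] assms]) auto

lemma Ck_s: "Ck_on k (\<lambda>y. s (fst y) (snd y)) (UNIV \<times> U)"
proof -
  have "Ck_on k (\<lambda>y :: real \<times> _. (- fst y * (\<Sum>i\<in>UNIV. lam i), fst (\<phi> (snd y)))) (UNIV \<times> U)"
    by (intro Ck_on_Pair Ck_on_mult Ck_on_const Ck_on_fst Ck_lift Ck_\<phi> open_times
        Ck_on_bounded_linear bounded_linear_minus bounded_linear_fst)
  from Ck_on_compose[OF open_times open_UNIV _ this Ck_on_height[of k "weight lam"]]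
  show ?thesis by (simp add: s_def)
qed

lemma Ck_X: "Ck_on k (\<lambda>y. X (fst y) j (snd y)) (UNIV \<times> U)"
  unfolding X_def
  by (intro Ck_on_add Ck_on_mult Ck_on_const Ck_on_exp_compose Ck_s open_times Ck_lift Ck_P)

lemma Ck_slice:
  assumes "Ck_on k f (UNIV \<times> U)" shows "Ck_on k (\<lambda>u. f (t, u)) U"
  by (rule Ck_on_compose[OF open_U open_times _
        Ck_on_Pair[OF open_U Ck_on_const[OF open_U] Ck_on_bounded_linear[OF bounded_linear_ident open_U]] assms])
    auto

lemma smooth_G: "smooth_on (UNIV \<times> U) (\<lambda>(t, u). G t u)"
  unfolding smooth_on_def
proof
  fix k
  have "Ck_on k (\<lambda>y. \<chi> j. of_real (X (fst y) j (snd y)) * exp (\<i> * of_real (weight lam j * h (snd y)))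
     + \<i> * of_real (shift j * h (snd y)) :: complex^('d option)) (UNIV \<times> U)"
    by (rule Ck_on_vec[OF open_times], unfold vec_lambda_beta)
      (intro Ck_on_add Ck_on_mult Ck_on_const Ck_on_exp_compose Ck_on_of_real Ck_X open_times Ck_lift Ck_h)
  then show "Ck_on k (\<lambda>(t, u). G t u) (UNIV \<times> U)"
    by (rule Ck_on_cong[OF _ open_times]) (auto simp: vec_eq_iff G_nth)
qed

lemma d\<phi>: "u \<in> U \<Longrightarrow> (\<phi> has_derivative frechet_derivative \<phi> (at u)) (at u)"
  by (rule Ck_on_has_derivative[OF Ck_\<phi> open_U])

lemma dP: "u \<in> U \<Longrightarrow> (P k has_derivative frechet_derivative (P k) (at u)) (at u)"
  by (rule Ck_on_has_derivative[OF Ck_P open_U])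

lemma dX: "u \<in> U \<Longrightarrow> (X t k has_derivative frechet_derivative (X t k) (at u)) (at u)"
  using Ck_on_has_derivative[OF Ck_slice[OF Ck_X] open_U] by simp

lemma ds: "u \<in> U \<Longrightarrow> (s t has_derivative frechet_derivative (s t) (at u)) (at u)"
  using Ck_on_has_derivative[OF Ck_slice[OF Ck_s] open_U] by simp

text \<open>The derivative of the complexified flow: the linear factor acts on \<open>dp + n ds\<close>, because a change of the
parameter \<open>s\<close> moves the point along the generator \<open>n\<close>.\<close>

lemma dX_eq:
  assumes "u \<in> U"
  shows "frechet_derivative (X t k) (at u) w = exp (weight lam k * s t u) *
     (frechet_derivative (P k) (at u) w + (weight lam k * P k u + shift k) * frechet_derivative (s t) (at u) w)"
proof -
  have "(X t k has_derivative (\<lambda>w. P k u * (weight lam k * frechet_derivative (s t) (at u) w * exp (weight lam k * s t u))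
      + frechet_derivative (P k) (at u) w * exp (weight lam k * s t u) + shift k * frechet_derivative (s t) (at u) w)) (at u)"
  proof -
    have "((\<lambda>u. f u * exp (a * g u) + b * g u) has_derivative
        (\<lambda>w. f u * (a * g' w * exp (a * g u)) + f' w * exp (a * g u) + b * g' w)) (at u)"
      if "(f has_derivative f') (at u)" "(g has_derivative g') (at u)" for f f' g g' and a b :: real
      by (auto intro!: derivative_eq_intros that)
    from this[OF dP ds] show ?thesis
      unfolding X_def[abs_def] using assms by blast
  qed
  from fun_cong[OF frechet_derivative_at[OF this], of w]
  have "frechet_derivative (X t k) (at u) w = P k u * (weight lam k * frechet_derivative (s t) (at u) w * exp (weight lam k * s t u))
      + frechet_derivative (P k) (at u) w * exp (weight lam k * s t u) + (shift k * exp (weight lam k * s t u)) * frechet_derivative (s t) (at u) w"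
    by (simp add: shift_exp)
  then show ?thesis by (simp add: algebra_simps)
qed

lemma P_level: "u \<in> U \<Longrightarrow> (\<Sum>k\<in>UNIV. (weight lam k * P k u + shift k) * frechet_derivative (P k) (at u) w) = 0"
  by (rule level_set_deriv[where c = "blinfun_apply c 1", OF open_U _ dP])
    (simp_all only: moment_map_real[OF real, symmetric] mu)

lemma X_level: "u \<in> U \<Longrightarrow> (\<Sum>k\<in>UNIV. (weight lam k * X t k u + shift k) * frechet_derivative (X t k) (at u) w) = 0"
proof (rule level_set_deriv[OF open_U _ dX])
  fix v assume v: "v \<in> U"
  have "blinfun_apply (moment_map lam (chi_curve lam (fst (\<phi> v)) t)) 1 = blinfun_apply c 1 - t * (\<Sum>i\<in>UNIV. lam i)"
    using v by (simp add: chi_curve_eq[OF real] moment_map_cflow[OF real] rise_height mu)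
  then show "(1/2) * (\<Sum>k\<in>UNIV. weight lam k * (X t k v)\<^sup>2) + (\<Sum>k\<in>UNIV. shift k * X t k v)
     = blinfun_apply c 1 - t * (\<Sum>i\<in>UNIV. lam i)"
    by (simp add: moment_map_real[OF curve_real] curve_nth v)
qed auto

text \<open>If \<open>dX\<close> vanishes on \<open>w\<close>, then \<open>dp = - n ds\<close> by the formula for \<open>dX\<close>. But \<open>dp\<close> is tangent to the level set,
hence orthogonal to its gradient \<open>n\<close>; so \<open>ds\<close> and \<open>dp\<close> vanish.\<close>

lemma immersive:
  assumes u: "u \<in> U" and X0: "\<And>k. frechet_derivative (X t k) (at u) w = 0"
    and h0: "frechet_derivative h (at u) w = 0"
  shows "w = 0"
proof -
  define n where "n k = weight lam k * P k u + shift k" for k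
  define \<sigma> where "\<sigma> = frechet_derivative (s t) (at u) w"
  have dP_eq: "frechet_derivative (P k) (at u) w = - n k * \<sigma>" for k
  proof -
    have "frechet_derivative (P k) (at u) w + n k * \<sigma> = 0"
      using X0[of k] by (simp add: dX_eq[OF u] n_def \<sigma>_def)
    then show ?thesis by (simp add: eq_neg_iff_add_eq_0)
  qed
  have "(\<Sum>k\<in>UNIV. (n k)\<^sup>2) * \<sigma> = - (\<Sum>k\<in>UNIV. n k * frechet_derivative (P k) (at u) w)"
    by (simp add: dP_eq sum_distrib_right power2_eq_square sum_negf mult.assoc)
  also have "\<dots> = 0"
    using P_level[OF u, of w] by (simp add: n_def)
  finally have "(\<Sum>k\<in>UNIV. (n k)\<^sup>2) * \<sigma> = 0" .
  moreover have "(\<Sum>k\<in>UNIV. (n k)\<^sup>2) > 0"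
    by (rule sum_pos2[of _ None]) (auto simp: n_def weight_def shift_def)
  ultimately have "\<sigma> = 0" by simp
  then have P0: "frechet_derivative (P k) (at u) w = 0" for k
    by (simp add: dP_eq)
  have "((\<lambda>u. (\<chi> k. complex_of_real (P k u), h u)) has_derivative
      (\<lambda>w. (\<chi> k. of_real (frechet_derivative (P k) (at u) w), frechet_derivative h (at u) w))) (at u)"
    by (intro has_derivative_Pair Ck_on_has_derivative[OF Ck_h open_U u] has_derivative_vec)
      (simp add: has_derivative_of_real dP[OF u])
  then have "(\<phi> has_derivative
      (\<lambda>w. (\<chi> k. of_real (frechet_derivative (P k) (at u) w), frechet_derivative h (at u) w))) (at u)"
    by (rule has_derivative_transform_within_open[OF _ open_U u])
      (use real in \<open>auto simp: prod_eq_iff vec_eq_iff real_points_def\<close>)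
  from fun_cong[OF frechet_derivative_at[OF this], of w] have "frechet_derivative \<phi> (at u) w = 0"
    by (auto simp: P0 h0 prod_eq_iff vec_eq_iff)
  moreover have "inj (frechet_derivative \<phi> (at u))"
    using imm u by (simp add: immersion_on_def)
  ultimately show "w = 0"
    using linear_injective_0[OF has_derivative_linear[OF d\<phi>[OF u]]] by blast
qed

lemma equivariant_map: "equivariant_map U (X t) h (weight lam) shift (G t) None"
proof
  show "Ck_on 2 (X t k) U" for k
    using Ck_slice[OF Ck_X] by simp
  show "w = 0" if "u \<in> U" "\<And>k. frechet_derivative (X t k) (at u) w = 0" "frechet_derivative h (at u) w = 0" for u w
    using that by (rule immersive)
  show "shift (None :: 'd option) \<noteq> 0" by (simp add: shift_def)
qed (fact open_U Ck_h weight_shift G_nth X_level)+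

text \<open>The group acts by affine maps with linear part \<open>E\<close>, so the velocity is \<open>E\<close> applied to \<open>\<chi>\<close>, and the general
formula for the mean curvature vector gives the same value.\<close>

lemma G_has_vector_derivative:
  assumes u: "u \<in> U"
  shows "((\<lambda>t. G t u) has_vector_derivative mean_curvature_vector (G t) u) (at t)"
  unfolding has_vector_derivative_def
proof (rule has_derivative_vec)
  fix k
  interpret equivariant_map U "X t" h "weight lam" shift "G t" None by (rule equivariant_map)
  let ?\<gamma> = "chi_curve lam (fst (\<phi> u))"
  have "is_chi_curve lam (fst (\<phi> u)) ?\<gamma>"
    by (simp add: is_chi_curve_iff[OF real[OF u]] chi_curve_eq[OF real[OF u]] fun_eq_iff)
  then have "(?\<gamma> has_vector_derivative chi_vf lam (?\<gamma> t)) (at t)"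
    by (simp add: is_chi_curve_def)
  then have "((\<lambda>t. ?\<gamma> t $ k) has_vector_derivative chi_vf lam (?\<gamma> t) $ k) (at t)"
    by (rule bounded_linear.has_vector_derivative[OF bounded_linear_vec_nth])
  then have "((\<lambda>t. ?\<gamma> t $ k * E k u + \<i> * of_real (shift k * h u)) has_vector_derivative
      chi_vf lam (?\<gamma> t) $ k * E k u + 0) (at t)"
    by (intro has_vector_derivative_add has_vector_derivative_const
        bounded_linear.has_vector_derivative[OF bounded_linear_mult_left])
  moreover have "chi_vf lam (?\<gamma> t) $ k * E k u = mean_curvature_vector (G t) u $ k"
    by (simp add: mean_curvature[OF u] chi_vf_nth[OF curve_real[OF u]] curve_nth[OF u] n_def sum_weight)
  ultimately show "((\<lambda>t. G t u $ k) has_derivative (\<lambda>x. (x *\<^sub>R mean_curvature_vector (G t) u) $ k)) (at t)"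
    by (simp add: has_vector_derivative_def G_def act_nth E_def)
qed

lemma G_immersion: "immersion_on U (G t)"
  and G_lagrangian: "u \<in> U \<Longrightarrow> kaehler_form (frechet_derivative (G t) (at u) v) (frechet_derivative (G t) (at u) w) = 0"
proof -
  interpret E: equivariant_map U "X t" h "weight lam" shift "G t" None by (rule equivariant_map)
  have "smooth_on U (G t)"
    using smooth_G Ck_slice[of _ "\<lambda>(t, u). G t u" t] by (simp add: smooth_on_def)
  then show "immersion_on U (G t)"
    using E.imm by (simp add: immersion_on_def)
  show "u \<in> U \<Longrightarrow> kaehler_form (frechet_derivative (G t) (at u) v) (frechet_derivative (G t) (at u) w) = 0"
    by (rule E.lagrangian)
qed

end

theorem proposition3p5:
  fixes lam :: "'d::finite \<Rightarrow> real"
    and c\<^sub>0 :: "real \<Rightarrow>\<^sub>L real"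
    and c :: "real \<Rightarrow> (real \<Rightarrow>\<^sub>L real)"
  assumes "\<And>t. c t = c\<^sub>0 - t *\<^sub>R a_H lam"
  shows "(\<forall>p\<in>real_points. \<exists>!\<gamma>. is_chi_curve lam p \<gamma>) \<and>
         lagrangian_mean_curvature_flow
           ((moment_map lam -` {c\<^sub>0} \<inter> real_points) \<times> (UNIV :: real set))
           (\<lambda>t (p, h). act lam (chi_curve lam p t) h)"
proof
  show "\<forall>p\<in>real_points. \<exists>!\<gamma>. is_chi_curve lam p \<gamma>"
    by (simp add: is_chi_curve_iff)
next
  let ?F = "\<lambda>t (p, h). act lam (chi_curve lam p t) h"
  have chart: "level_set_chart lam c\<^sub>0 U \<phi>"
    if "local_param (level_set lam c\<^sub>0 \<times> UNIV) U \<phi>" for U and \<phi> :: "real^('d option) \<Rightarrow> (complex^('d option)) \<times> real"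
  proof
    show "open U" "immersion_on U \<phi>"
      using that by (simp_all add: local_param_def)
    show "\<phi> u \<in> level_set lam c\<^sub>0 \<times> UNIV" if "u \<in> U" for u
      using that \<open>local_param _ U \<phi>\<close> openin_imp_subset unfolding local_param_def by blast
  qed
  show "lagrangian_mean_curvature_flow ((moment_map lam -` {c\<^sub>0} \<inter> real_points) \<times> UNIV) ?F"
    unfolding lagrangian_mean_curvature_flow_def lagrangian_immersion_def level_set_def[symmetric]
  proof (intro conjI allI impI ballI)
    show "submanifold TYPE('d option) (level_set lam c\<^sub>0 \<times> (UNIV :: real set))"
      by (rule submanifold_level_set)
    fix U and \<phi> :: "real^('d option) \<Rightarrow> (complex^('d option)) \<times> real" and t
    assume "local_param (level_set lam c\<^sub>0 \<times> UNIV) U \<phi>"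
    then interpret level_set_chart lam c\<^sub>0 U \<phi> by (rule chart)
    have F: "?F t \<circ> \<phi> = G t" "?F t (\<phi> u) = G t u" for t u
      by (simp_all add: G_def case_prod_unfold fun_eq_iff)
    show "immersion_on U (?F t \<circ> \<phi>)"
      unfolding F by (rule G_immersion)
    show "smooth_on (UNIV \<times> U) (\<lambda>(t, u). ?F t (\<phi> u))"
      unfolding F by (rule smooth_G)
    fix u assume u: "u \<in> U"
    show "((\<lambda>s. ?F s (\<phi> u)) has_vector_derivative mean_curvature_vector (?F t \<circ> \<phi>) u) (at t)"
      unfolding F by (rule G_has_vector_derivative[OF u])
    show "kaehler_form (frechet_derivative (?F t \<circ> \<phi>) (at u) v) (frechet_derivative (?F t \<circ> \<phi>) (at u) w) = 0" for v w
      unfolding F by (rule G_lagrangian[OF u])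
  qed
qed

end
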